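(* For every $\tau\in\mathbb{H}^2$ set $$g(\tau)=q\prod_{n=1}^{\infty}\frac{(1-q^{5n-1})^5(1-q^{5n-4})^5}{(1-q^{5n-2})^5(1-q^{5n-3})^5},\qquad q=\exp(2\pi i\tau).$$ Then $$\{g,\tau\}+\frac{g^4+12g^3+134g^2-12g+1}{2g^2\left(g^2+11g-1\right)^2}\,(g')^2=0 .$$
   Context: $\mathbb{H}^2=\{\tau\in\mathbb{C}\mid \Im\tau>0\}$. The prime denotes $d/d\tau$, and the Schwarzian derivative of $y=y(x)$ is $\{y,x\}=\frac{y'''}{y'}-\frac32\left(\frac{y''}{y'}\right)^2$, derivatives being taken with respect to $x$. *)

theory Defs
  imports "HOL-Complex_Analysis.Complex_Analysis"
begin

definition schwarzian :: "(complex \<Rightarrow> complex) \<Rightarrow> complex \<Rightarrow> complex" where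
  "schwarzian y x =
     (deriv ^^ 3) y x / deriv y x - 3 / 2 * ((deriv ^^ 2) y x / deriv y x) ^ 2"

definition nome :: "complex \<Rightarrow> complex" where
  "nome \<tau> = exp (2 * of_real pi * \<i> * \<tau>)"

(* The library product starts at index 0, so its k-th factor is the one for n = Suc k, and the
   subtractions in the exponents never truncate.  Only Im \<tau> > 0 is meant; since that half-plane
   is open, derivatives of g5 at its points do not depend on the values of g5 elsewhere. *)
definition g5 :: "complex \<Rightarrow> complex" where
  "g5 \<tau> = (let q = nome \<tau> in
     q * (\<Prod>k. let n = Suc k in
       ((1 - q ^ (5 * n - 1)) ^ 5 * (1 - q ^ (5 * n - 4)) ^ 5) /
       ((1 - q ^ (5 * n - 2)) ^ 5 * (1 - q ^ (5 * n - 3)) ^ 5)))"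

end

theory Submission
  imports Defs
begin

text \<open>
Write \<open>D\<close> for \<open>q d/dq\<close>, which is \<open>d/d\<tau>\<close> divided by \<open>2 \<pi> \<i>\<close>. The function \<open>g\<close> is the fifth power of the
Rogers--Ramanujan continued fraction and generates the function field of the modular curve for
\<open>\<Gamma>\<^sub>1(5)\<close>. The equation for its Schwarzian derivative follows from knowing how \<open>D\<close> acts on the
modular forms of that group. Three functions of \<open>q\<close> suffice: the forms \<open>a = 1 + 3q + \<dots>\<close> and
\<open>b = q + \<dots>\<close> of weight one and a quasimodular \<open>R\<close> of weight two. They satisfy
(\<open>level_five_ramanujan_system\<close>)

  \<open>2 D a = a (11 a b + 2 b^2 - R)\<close>,
  \<open>2 D b = b (2 a^2 - 11 a b - R)\<close>,
  \<open>2 D R = 5 a b (2 a^2 + 3 a b - 2 b^2) - R^2\<close>.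

Put \<open>E = a^2 - 11 a b - b^2\<close>. The system gives \<open>D (b/a) = (b/a) E\<close> and \<open>D E = - E R\<close>, while the logarithmic
derivative of the infinite product gives \<open>D g = g E\<close>. Hence \<open>b/a\<close> is a constant times \<open>g\<close>, and comparing
the coefficients of \<open>q\<close> shows that \<open>b = a g\<close> (\<open>form_b_eq_form_a_times_quotient\<close>). From \<open>D g = g E\<close> and
\<open>D E = - E R\<close> the Schwarzian derivative of \<open>g\<close> with respect to \<open>\<tau>\<close> is \<open>(2 \<pi> \<i>)^2\<close> times
\<open>- (R^2 + 2 D R + E^2) / 2\<close>. The equation for \<open>D R\<close> removes \<open>R\<close> from this expression, and what is left is
a quartic form in \<open>a\<close> and \<open>b\<close>, namely \<open>a^4\<close> times the numerator in the theorem
(\<open>schwarzian_algebra\<close>). The denominator matches because \<open>E = - a^2 (g^2 + 11 g - 1)\<close>.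

The differential system comes from elliptic functions. For a nome \<open>Q\<close> let \<open>\<phi>(x)\<close> be the theta function
\<open>Q^(1/12) x^(-1/2) (1 - x) \<Prod> (1 - Q^n x) (1 - Q^n / x)\<close>, and let \<open>J\<close> and \<open>H\<close> be the derivatives of
\<open>- log \<phi>\<close> under \<open>x d/dx\<close> and \<open>Q d/dQ\<close>. In the annulus \<open>|Q| < |x| < 1\<close> they are Laurent series in \<open>x\<close> whose
coefficients are rational functions of \<open>Q^n\<close>, and two relations hold:

  \<open>J(x) J(y) - J(xy) (J(x) + J(y)) = H(x) + H(y) + H(xy)\<close>, the addition theorem;
  \<open>x J'(x) = J(x)^2 + 2 H(x) + K\<close> with \<open>K\<close> depending on \<open>Q\<close> only, the heat equation.

Both are identities between Laurent coefficients and reduce to partial fractions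
(\<open>three_term_identity_weighted\<close>, \<open>heat_equation_weighted\<close>); weighting the coefficients by powers of the
exponents gives the \<open>x\<close>-derivatives of the relations. Now take \<open>Q = q^5\<close> and \<open>x = q^i\<close> for \<open>0 < i < 5\<close>,
which are the points of order five. They lie inside the annulus, and elementary formulas
relate the values at \<open>i\<close> and \<open>5 - i\<close>. So the relations become polynomial equations, and solving them expresses every
value that occurs through \<open>J(q)\<close>, \<open>J(q^2)\<close> and the derivative of \<open>J\<close> at \<open>q\<close>, equivalently
through \<open>a\<close>, \<open>b\<close> and \<open>R\<close>. Since both \<open>Q\<close> and \<open>x\<close> move with \<open>q\<close>, the derivative \<open>D\<close> of \<open>J(q^i)\<close>
is \<open>i x J'(x) + 5 x H'(x)\<close>, and this closes the system.
\<close>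

section \<open>Laurent coefficients of the logarithmic derivatives of theta\<close>

text \<open>
The coefficients of \<open>J\<close>. Up to sign and a multiple of the logarithm of \<open>x\<close>, this is the
Weierstrass zeta function. The value \<open>1/2\<close> at \<open>0\<close> is the one for which the reflection
\<open>zeta_coeff_minus\<close> also holds there.
\<close>

definition zeta_coeff :: "complex \<Rightarrow> int \<Rightarrow> complex" where
  "zeta_coeff Q n = (if n = 0 then 1 / 2 else 1 / (1 - Q powi n))"

text \<open>
The coefficients of \<open>H\<close>; for \<open>n \<noteq> 0\<close> they equal \<open>Q^n / (1 - Q^n)^2\<close>. The value at \<open>0\<close> is forced by
comparing the constant terms in the addition theorem; it matches the factor \<open>Q^(1/12)\<close> of \<open>\<phi>\<close>.
\<close>

definition theta_coeff :: "complex \<Rightarrow> int \<Rightarrow> complex" where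
  "theta_coeff Q n = (if n = 0 then - 1 / 12 else zeta_coeff Q n ^ 2 - zeta_coeff Q n)"

lemma powi_neq_1:
  fixes Q :: complex
  assumes "0 < norm Q" "norm Q < 1" "n \<noteq> 0"
  shows "Q powi n \<noteq> 1"
proof
  assume "Q powi n = 1"
  hence *: "norm Q powi n = 1"
    by (metis norm_one norm_power_int)
  have pos: "norm Q powi m \<noteq> 1" if "m > 0" for m
  proof -
    have "norm Q ^ nat m < 1"
      using assms that by (simp add: power_less_one_iff)
    thus ?thesis using that by (simp add: power_int_def)
  qed
  show False
  proof (cases "n > 0")
    case False
    hence "norm Q powi (-n) = 1" using * by (simp add: power_int_minus)
    thus False using pos[of "-n"] False assms(3) by auto
  qed (use pos * in auto)
qed

lemma zeta_coeff_minus: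
  assumes "0 < norm Q" "norm Q < 1"
  shows "zeta_coeff Q (- n) = 1 - zeta_coeff Q n"
proof (cases "n = 0")
  case False
  have "Q powi n \<noteq> 1" "Q powi n \<noteq> 0" using powi_neq_1[OF assms False] assms by auto
  thus ?thesis using False
    by (auto simp: zeta_coeff_def power_int_minus divide_simps) (auto simp: field_simps)
qed (simp add: zeta_coeff_def)

lemma theta_coeff_minus:
  assumes "0 < norm Q" "norm Q < 1"
  shows "theta_coeff Q (- n) = theta_coeff Q n"
  by (simp add: theta_coeff_def zeta_coeff_minus[OF assms] power2_eq_square algebra_simps)

text \<open>
Partial fractions: with \<open>A = Q^m\<close> and \<open>B = Q^n\<close> one has \<open>1 - A B = (1 - A) + (1 - B) - (1 - A) (1 - B)\<close>.
\<close>

lemma zeta_coeff_mult: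
  assumes "0 < norm Q" "norm Q < 1" "m \<noteq> 0" "n \<noteq> 0" "m + n \<noteq> 0"
  shows "zeta_coeff Q m * zeta_coeff Q n = zeta_coeff Q (m + n) * (zeta_coeff Q m + zeta_coeff Q n - 1)"
proof -
  have "Q powi m \<noteq> 1" "Q powi n \<noteq> 1" "Q powi (m + n) \<noteq> 1" "Q \<noteq> 0"
    using powi_neq_1[OF assms(1,2)] assms by auto
  thus ?thesis using assms
    by (simp add: zeta_coeff_def power_int_add divide_simps) (simp add: algebra_simps)
qed

text \<open>
The left-hand side is the coefficient of \<open>x^m y^n\<close> in \<open>J(x) J(y) - J(xy) J(x) - J(xy) J(y)\<close>. By partial
fractions it vanishes off the two axes and the diagonal, where the monomial is a power of \<open>x\<close>, of \<open>y\<close>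
or of \<open>xy\<close>; this is why the right-hand side of the addition theorem separates the variables.
\<close>

lemma zeta_coeff_three_term:
  assumes "0 < norm Q" "norm Q < 1"
  shows "zeta_coeff Q m * zeta_coeff Q n - zeta_coeff Q n * zeta_coeff Q (m - n) - zeta_coeff Q m * zeta_coeff Q (n - m)
     = (if n = 0 then theta_coeff Q m else 0) + (if m = 0 then theta_coeff Q n else 0) + (if m = n then theta_coeff Q n else 0)"
proof -
  have s: "zeta_coeff Q (n - m) = 1 - zeta_coeff Q (m - n)"
    using zeta_coeff_minus[OF assms, of "m - n"] by simp
  have s': "zeta_coeff Q (- k) = 1 - zeta_coeff Q k" for k by (rule zeta_coeff_minus[OF assms])
  consider "m = 0 \<or> n = 0 \<or> m = n" | "m \<noteq> 0" "n \<noteq> 0" "m - n \<noteq> 0" by auto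
  thus ?thesis
  proof cases
    case 1
    thus ?thesis
      by (auto simp: theta_coeff_def s s' power2_eq_square algebra_simps) (auto simp: zeta_coeff_def)
  next
    case 2
    thus ?thesis using zeta_coeff_mult[OF assms, of n "m - n"] by (simp add: s algebra_simps)
  qed
qed

section \<open>The addition theorem and the heat equation\<close>

lemma has_sum_product_complex:
  fixes f :: "'a \<Rightarrow> complex" and g :: "'b \<Rightarrow> complex"
  assumes "(f has_sum S) A" "(g has_sum R) B"
  shows "((\<lambda>(m, n). f m * g n) has_sum (S * R)) (A \<times> B)"
proof (rule has_sum_SigmaI)
  show "((\<lambda>n. case (m, n) of (m, n) \<Rightarrow> f m * g n) has_sum f m * R) B" for m
    using has_sum_cmult_right[OF assms(2), of "f m"] by simp
  show "((\<lambda>m. f m * R) has_sum S * R) A"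
    by (rule has_sum_cmult_left[OF assms(1)])
  have f: "(\<lambda>m. norm (f m)) summable_on A" and g: "(\<lambda>m. norm (g m)) summable_on B"
    using assms has_sum_imp_summable summable_on_iff_abs_summable_on_complex by blast+
  have "(\<lambda>p. norm (case p of (m, n) \<Rightarrow> f m * g n)) summable_on A \<times> B"
    unfolding Infinite_Sum.abs_summable_on_Sigma_iff
    using summable_on_cmult_left[OF f] summable_on_cmult_right[OF g]
    by (auto simp: norm_mult infsum_cmult_right' infsum_nonneg abs_mult)
  thus "(\<lambda>(m, n). f m * g n) summable_on A \<times> B"
    by (rule Infinite_Sum.abs_summable_summable)
qed

text \<open>
The addition theorem after \<open>k\<close> applications of \<open>x d/dx - y d/dy\<close>, which multiplies the coefficient of
\<open>x^m y^n\<close> by \<open>(m - n)^k\<close>. This operator leaves functions of \<open>xy\<close> alone, so only the factor \<open>J(xy)\<close> without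
derivatives occurs. The sum \<open>P\<close> stands for the result of applying the operator to \<open>J(x) J(y)\<close>, whose
expansion by the product rule depends on \<open>k\<close>.
\<close>

lemma three_term_identity_weighted:
  fixes x y Q :: complex
  assumes Q: "0 < norm Q" "norm Q < 1" and nz: "x \<noteq> 0" "y \<noteq> 0"
    and X: "((\<lambda>n. of_int n ^ k * zeta_coeff Q n * x powi n) has_sum X) UNIV"
    and Y: "((\<lambda>n. of_int n ^ k * zeta_coeff Q n * y powi n) has_sum Y) UNIV"
    and W: "((\<lambda>n. zeta_coeff Q n * (x * y) powi n) has_sum W) UNIV"
    and MX: "((\<lambda>n. of_int n ^ k * theta_coeff Q n * x powi n) has_sum MX) UNIV"
    and MY: "((\<lambda>n. of_int n ^ k * theta_coeff Q n * y powi n) has_sum MY) UNIV"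
    and MW: "((\<lambda>n. theta_coeff Q n * (x * y) powi n) has_sum MW) UNIV"
    and P: "((\<lambda>(m, n). of_int (m - n) ^ k * (zeta_coeff Q m * zeta_coeff Q n) * (x powi m * y powi n)) has_sum P) UNIV"
  shows "P - W * (X + (- 1) ^ k * Y) = MX + (- 1) ^ k * MY + (if k = 0 then MW else 0)"
proof -
  \<comment> \<open>The substitution \<open>m = i + l\<close>, \<open>n = i\<close> turns \<open>(x y)^i x^l\<close> into \<open>x^m y^n\<close>; for \<open>y\<close> it is \<open>m = i\<close>, \<open>n = i + l\<close>.\<close>
  have PX: "((\<lambda>(m, n). of_int (m - n) ^ k * (zeta_coeff Q n * zeta_coeff Q (m - n)) * (x powi m * y powi n))
          has_sum (W * X)) UNIV"
  proof -
    have "((\<lambda>(m, n). of_int (m - n) ^ k * (zeta_coeff Q n * zeta_coeff Q (m - n)) * (x powi m * y powi n))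
          has_sum (W * X)) (UNIV \<times> UNIV) \<longleftrightarrow>
          ((\<lambda>(i, l). (zeta_coeff Q i * (x * y) powi i) * (of_int l ^ k * zeta_coeff Q l * x powi l)) has_sum (W * X)) (UNIV \<times> UNIV)"
      by (rule has_sum_reindex_bij_witness[where i = "\<lambda>(i, l). (i + l, i)" and j = "\<lambda>(m, n). (n, m - n)"])
         (use nz in \<open>auto simp: power_int_add power_int_mult_distrib power_int_diff field_simps\<close>)
    with has_sum_product_complex[OF W X] show ?thesis by simp
  qed
  have PY: "((\<lambda>(m, n). of_int (m - n) ^ k * (zeta_coeff Q m * zeta_coeff Q (n - m)) * (x powi m * y powi n))
          has_sum (W * ((- 1) ^ k * Y))) UNIV"
  proof -
    have sgn: "complex_of_int (m - n) ^ k = (- 1) ^ k * of_int (n - m) ^ k" for m n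
      by (metis minus_diff_eq mult_minus1 of_int_minus power_mult_distrib)
    have trm: "zeta_coeff Q m * (x * y) powi m * ((- 1) ^ k * (of_int (n - m) ^ k * zeta_coeff Q (n - m) * y powi (n - m)))
        = of_int (m - n) ^ k * (zeta_coeff Q m * zeta_coeff Q (n - m)) * (x powi m * y powi n)" for m n
      unfolding sgn[of m n] using nz by (simp add: power_int_mult_distrib power_int_diff)
    have "((\<lambda>(m, n). of_int (m - n) ^ k * (zeta_coeff Q m * zeta_coeff Q (n - m)) * (x powi m * y powi n))
          has_sum (W * ((- 1) ^ k * Y))) (UNIV \<times> UNIV) \<longleftrightarrow>
          ((\<lambda>(i, l). (zeta_coeff Q i * (x * y) powi i) * ((- 1) ^ k * (of_int l ^ k * zeta_coeff Q l * y powi l)))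
            has_sum (W * ((- 1) ^ k * Y))) (UNIV \<times> UNIV)"
      by (rule has_sum_reindex_bij_witness[where i = "\<lambda>(i, l). (i, i + l)" and j = "\<lambda>(m, n). (m, n - m)"])
         (auto simp: trm simp del: of_int_diff)
    with has_sum_product_complex[OF W has_sum_cmult_right[OF Y]] show ?thesis by simp
  qed
  let ?h = "\<lambda>(m, n). of_int (m - n) ^ k * ((if n = 0 then theta_coeff Q m else 0) + (if m = 0 then theta_coeff Q n else 0) + (if m = n then theta_coeff Q n else 0)) * (x powi m * y powi n)"
  have 1: "(?h has_sum (P - W * X - W * ((- 1) ^ k * Y))) UNIV"
  proof -
    have "((\<lambda>p. (case p of (m, n) \<Rightarrow> of_int (m - n) ^ k * (zeta_coeff Q m * zeta_coeff Q n) * (x powi m * y powi n))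
       + - (case p of (m, n) \<Rightarrow> of_int (m - n) ^ k * (zeta_coeff Q n * zeta_coeff Q (m - n)) * (x powi m * y powi n))
       + - (case p of (m, n) \<Rightarrow> of_int (m - n) ^ k * (zeta_coeff Q m * zeta_coeff Q (n - m)) * (x powi m * y powi n)))
       has_sum (P + - (W * X) + - (W * ((- 1) ^ k * Y)))) UNIV"
      by (intro has_sum_add has_sum_uminusI P PX PY)
    moreover have "(case p of (m, n) \<Rightarrow> of_int (m - n) ^ k * (zeta_coeff Q m * zeta_coeff Q n) * (x powi m * y powi n))
       + - (case p of (m, n) \<Rightarrow> of_int (m - n) ^ k * (zeta_coeff Q n * zeta_coeff Q (m - n)) * (x powi m * y powi n))
       + - (case p of (m, n) \<Rightarrow> of_int (m - n) ^ k * (zeta_coeff Q m * zeta_coeff Q (n - m)) * (x powi m * y powi n))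
       = ?h p" for p
      by (cases p) (simp only: prod.case zeta_coeff_three_term[OF Q, symmetric], simp add: algebra_simps)
    ultimately show ?thesis by simp
  qed
  have axis1: "((\<lambda>(m, n). of_int (m - n) ^ k * (if n = 0 then theta_coeff Q m else 0) * (x powi m * y powi n)) has_sum MX) UNIV"
  proof -
    have "((\<lambda>(m, n). of_int (m - n) ^ k * (if n = 0 then theta_coeff Q m else 0) * (x powi m * y powi n)) has_sum MX)
       ((\<lambda>m. (m, 0)) ` UNIV)"
      by (subst has_sum_reindex) (use MX in \<open>auto simp: inj_on_def o_def mult_ac\<close>)
    thus ?thesis by (rule has_sum_cong_neutral[THEN iffD1, rotated -1]) auto
  qed
  have axis2: "((\<lambda>(m, n). of_int (m - n) ^ k * (if m = 0 then theta_coeff Q n else 0) * (x powi m * y powi n)) has_sum ((- 1) ^ k * MY)) UNIV"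
  proof -
    have "((\<lambda>(m, n). of_int (m - n) ^ k * (if m = 0 then theta_coeff Q n else 0) * (x powi m * y powi n)) has_sum ((- 1) ^ k * MY))
       ((\<lambda>m. (0, m)) ` UNIV)"
      by (subst has_sum_reindex)
         (use has_sum_cmult_right[OF MY, of "(- 1) ^ k"] in
           \<open>auto simp: inj_on_def o_def mult_ac power_mult_distrib[symmetric]\<close>)
    thus ?thesis by (rule has_sum_cong_neutral[THEN iffD1, rotated -1]) auto
  qed
  have diag: "((\<lambda>(m, n). of_int (m - n) ^ k * (if m = n then theta_coeff Q n else 0) * (x powi m * y powi n)) has_sum (if k = 0 then MW else 0)) UNIV"
  proof -
    have "((\<lambda>(m, n). of_int (m - n) ^ k * (if m = n then theta_coeff Q n else 0) * (x powi m * y powi n)) has_sum (if k = 0 then MW else 0))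
       ((\<lambda>m. (m, m)) ` UNIV)"
      by (subst has_sum_reindex)
         (use MW in \<open>auto simp: inj_on_def o_def mult_ac power_int_mult_distrib power_0_left\<close>)
    thus ?thesis by (rule has_sum_cong_neutral[THEN iffD1, rotated -1]) auto
  qed
  have 2: "(?h has_sum (MX + (- 1) ^ k * MY + (if k = 0 then MW else 0))) UNIV"
    using has_sum_add[OF has_sum_add[OF axis1 axis2] diag]
    by (rule has_sum_cong[THEN iffD1, rotated]) (auto simp: algebra_simps)
  show ?thesis using has_sum_unique[OF 1 2] by (simp add: algebra_simps)
qed

lemma zeta_product_has_sum:
  fixes x y Q :: complex
  assumes "((\<lambda>n. of_int n ^ i * zeta_coeff Q n * x powi n) has_sum X) UNIV"
    and "((\<lambda>n. of_int n ^ j * zeta_coeff Q n * y powi n) has_sum Y) UNIV"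
  shows "((\<lambda>(m, n). of_int m ^ i * of_int n ^ j * (zeta_coeff Q m * zeta_coeff Q n) * (x powi m * y powi n)) has_sum X * Y) UNIV"
  using has_sum_product_complex[OF assms] by (simp add: mult_ac)

text \<open>
The coefficients tend to \<open>1\<close> at \<open>\<infinity>\<close> and to \<open>0\<close> at \<open>-\<infinity>\<close>, so each shift by one contributes exactly \<open>1\<close>.
\<close>

lemma zeta_coeff_telescope:
  assumes Q: "0 < norm Q" "norm Q < 1"
  shows "((\<lambda>m. zeta_coeff Q m - zeta_coeff Q (m - n)) has_sum of_int n) UNIV"
proof -
  \<comment> \<open>Apart from a step function the coefficients decay geometrically, and the sum over the decaying part does not change under shifts.\<close>
  define r where "r m = (if m > 0 then zeta_coeff Q m - 1 else if m = 0 then 0 else zeta_coeff Q m)" for m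
  define st :: "int \<Rightarrow> complex" where "st m = (if m > 0 then 1 else if m = 0 then 1/2 else 0)" for m
  have split: "zeta_coeff Q m = st m + r m" for m by (auto simp: r_def st_def zeta_coeff_def)
  have bound: "norm (r m) \<le> norm Q ^ nat \<bar>m\<bar> / (1 - norm Q)" for m
  proof -
    have *: "norm (Q ^ n / (1 - Q ^ n)) \<le> norm Q ^ n / (1 - norm Q)" if "n > 0" for n
    proof -
      have "norm (Q ^ n) \<le> norm Q ^ 1" unfolding norm_power
        using that Q by (intro power_decreasing) auto
      hence "1 - norm Q \<le> norm (1 - Q ^ n)"
        using norm_triangle_ineq2[of 1 "Q ^ n"] by simp
      thus ?thesis using Q by (auto simp: norm_divide norm_power intro!: divide_left_mono mult_pos_pos)
    qed
    consider "m = 0" | "m > 0" | "m < 0" by linarith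
    thus ?thesis
    proof cases
      case 2
      have ne: "Q ^ nat m \<noteq> 1" using powi_neq_1[OF Q, of m] 2 by (simp add: power_int_def)
      have "r m = Q ^ nat m / (1 - Q ^ nat m)"
        using 2 ne by (auto simp: r_def zeta_coeff_def power_int_def field_simps)
      thus ?thesis using *[of "nat m"] 2 by simp
    next
      case 3
      have ne: "Q ^ nat (-m) \<noteq> 1" using powi_neq_1[OF Q, of "-m"] 3 by (simp add: power_int_def)
      have "r m = 1 - zeta_coeff Q (-m)" using 3 zeta_coeff_minus[OF Q, of "-m"] by (simp add: r_def)
      also have "\<dots> = - (Q ^ nat (-m) / (1 - Q ^ nat (-m)))"
        using 3 ne by (auto simp: zeta_coeff_def power_int_def field_simps)
      finally show ?thesis using *[of "nat (-m)"] 3 by simp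
    qed (use Q in \<open>auto simp: r_def\<close>)
  qed
  have "r summable_on UNIV"
  proof -
    have g: "(\<lambda>n. norm Q ^ n / (1 - norm Q)) summable_on (UNIV :: nat set)"
      using Q by (intro summable_nonneg_imp_summable_on summable_divide summable_geometric) auto
    have "(\<lambda>m. norm Q ^ nat \<bar>m\<bar> / (1 - norm Q)) summable_on {0..}"
      using g by (subst summable_on_reindex_bij_witness[where i = int and j = nat and T = UNIV and h = "\<lambda>n. norm Q ^ n / (1 - norm Q)"]) auto
    moreover have "(\<lambda>m. norm Q ^ nat \<bar>m\<bar> / (1 - norm Q)) summable_on {..0}"
      using g by (subst summable_on_reindex_bij_witness[where i = "\<lambda>n. - int n" and j = "\<lambda>n. nat (-n)" and T = UNIV and h = "\<lambda>n. norm Q ^ n / (1 - norm Q)"]) auto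
    ultimately have "(\<lambda>m. norm Q ^ nat \<bar>m\<bar> / (1 - norm Q)) summable_on {0..} \<union> {..0}"
      by (rule summable_on_union)
    moreover have "{0..} \<union> {..0} = (UNIV :: int set)" by auto
    ultimately have "(\<lambda>m. norm Q ^ nat \<bar>m\<bar> / (1 - norm Q)) summable_on (UNIV :: int set)" by simp
    hence "(\<lambda>m. norm (r m)) summable_on UNIV"
      by (rule Infinite_Sum.abs_summable_on_comparison_test') (use bound in auto)
    thus ?thesis by (rule Infinite_Sum.abs_summable_summable)
  qed
  then obtain R where R: "(r has_sum R) UNIV" by (auto simp: summable_on_def)
  have shift: "((\<lambda>m. f (m + k)) has_sum s) UNIV \<longleftrightarrow> (f has_sum s) UNIV" for f :: "int \<Rightarrow> complex" and k s
    by (rule has_sum_reindex_bij_witness[where i = "\<lambda>m. m - k" and j = "\<lambda>m. m + k"]) auto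
  have one: "((\<lambda>m. zeta_coeff Q m - zeta_coeff Q (m - 1)) has_sum 1) UNIV"
  proof -
    have "((\<lambda>m. r (m + (- 1))) has_sum R) UNIV" using R shift by blast
    hence "((\<lambda>m. r m + - r (m + (- 1))) has_sum R + - R) UNIV"
      by (intro has_sum_add R has_sum_uminusI)
    moreover have "((\<lambda>m. st m - st (m - 1)) has_sum 1) UNIV"
      by (rule has_sum_finite_neutralI[where B = "{0, 1}"]) (auto simp: st_def)
    ultimately have "((\<lambda>m. (r m + - r (m + (- 1))) + (st m - st (m - 1))) has_sum (R + - R) + 1) UNIV"
      by (rule has_sum_add)
    thus ?thesis by (simp add: split algebra_simps)
  qed
  have nat: "((\<lambda>m. zeta_coeff Q m - zeta_coeff Q (m - int n)) has_sum of_nat n) UNIV" for n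
  proof (induction n)
    case (Suc n)
    have "((\<lambda>m. zeta_coeff Q (m + (- 1)) - zeta_coeff Q (m + (-1) - int n)) has_sum of_nat n) UNIV"
      using Suc shift[of "\<lambda>m. zeta_coeff Q m - zeta_coeff Q (m - int n)"] by blast
    from has_sum_add[OF this one] show ?case by (simp add: algebra_simps)
  qed simp
  show ?thesis
  proof (cases "n \<ge> 0")
    case True
    thus ?thesis using nat[of "nat n"] by simp
  next
    case False
    have "((\<lambda>m. zeta_coeff Q m - zeta_coeff Q (m + n)) has_sum - of_int n) UNIV"
      using nat[of "nat (- n)"] False by simp
    hence "((\<lambda>m. zeta_coeff Q (m + (- n)) - zeta_coeff Q (m + (- n) + n)) has_sum - of_int n) UNIV"
      using shift[of "\<lambda>m. zeta_coeff Q m - zeta_coeff Q (m + n)" "- n"] by blast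
    from has_sum_uminusI[OF this] show ?thesis by simp
  qed
qed

text \<open>
The coefficient of \<open>x^n\<close> in \<open>J(x)^2\<close>. Partial fractions turn the product into a difference of shifted
coefficients, which telescopes; the correction comes from the two summands \<open>m = 0\<close> and \<open>m = n\<close>, for which the
partial fraction identity fails.
\<close>

lemma zeta_coeff_convolution:
  assumes Q: "0 < norm Q" "norm Q < 1" and n: "n \<noteq> 0"
  shows "((\<lambda>m. zeta_coeff Q m * zeta_coeff Q (n - m)) has_sum (of_int n * zeta_coeff Q n - 2 * theta_coeff Q n)) UNIV"
proof -
  have A: "((\<lambda>m. zeta_coeff Q n * (zeta_coeff Q m - zeta_coeff Q (m - n))) has_sum (zeta_coeff Q n * of_int n)) UNIV"
    by (intro has_sum_cmult_right zeta_coeff_telescope Q)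
  have B: "((\<lambda>m. if m \<in> {0, n} then - theta_coeff Q n else 0) has_sum (- 2 * theta_coeff Q n)) UNIV"
    by (rule has_sum_finite_neutralI[where B = "{0, n}"]) (use n in auto)
  have l0: "zeta_coeff Q 0 = 1 / 2" by (simp add: zeta_coeff_def)
  have key: "zeta_coeff Q m * zeta_coeff Q (n - m) = zeta_coeff Q n * (zeta_coeff Q m - zeta_coeff Q (m - n)) + (if m \<in> {0, n} then - theta_coeff Q n else 0)" for m
  proof -
    consider "m = 0" | "m = n" | "m \<noteq> 0" "m \<noteq> n" by blast
    thus ?thesis
    proof cases
      case 1
      thus ?thesis using n
        by (simp add: theta_coeff_def zeta_coeff_minus[OF Q] l0 power2_eq_square field_simps)
    next
      case 2
      thus ?thesis using n by (simp add: theta_coeff_def l0 power2_eq_square field_simps)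
    next
      case 3
      have l0: "zeta_coeff Q 0 = 1 / 2" by (simp add: zeta_coeff_def)
  have key: "zeta_coeff Q m * zeta_coeff Q (n - m) = zeta_coeff Q n * (zeta_coeff Q m + zeta_coeff Q (n - m) - 1)"
        using zeta_coeff_mult[OF Q, of m "n - m"] 3 n by simp
      moreover have "zeta_coeff Q (n - m) = 1 - zeta_coeff Q (m - n)" using zeta_coeff_minus[OF Q, of "m - n"] by simp
      ultimately show ?thesis using 3 by simp
    qed
  qed
  show ?thesis unfolding key using has_sum_add[OF A B] by (simp add: mult.commute)
qed

text \<open>
The heat equation after \<open>k\<close> applications of \<open>x d/dx\<close>, again coefficient by coefficient. The number \<open>K\<close>
is defined by the constant term of \<open>J(x)^2\<close>; the summand \<open>1/6\<close> compensates the contribution of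
\<open>theta_coeff Q 0\<close>. As \<open>P\<close> collects all terms of total degree \<open>n\<close> with weight \<open>n^k\<close>, it is the result of
applying \<open>x d/dx\<close> to \<open>J(x)^2\<close>.
\<close>

lemma heat_equation_weighted:
  fixes x Q :: complex
  assumes Q: "0 < norm Q" "norm Q < 1" and nz: "x \<noteq> 0"
    and X: "((\<lambda>n. of_int n ^ Suc k * zeta_coeff Q n * x powi n) has_sum X) UNIV"
    and M: "((\<lambda>n. of_int n ^ k * theta_coeff Q n * x powi n) has_sum M) UNIV"
    and P: "((\<lambda>(m, n). of_int (m + n) ^ k * (zeta_coeff Q m * zeta_coeff Q n) * (x powi m * x powi n)) has_sum P) UNIV"
    and K: "((\<lambda>m. zeta_coeff Q m * zeta_coeff Q (- m)) has_sum - K + 1/6) UNIV"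
  shows "P = X - 2 * M - (if k = 0 then K else 0)"
proof -
  have "((\<lambda>(n, m). of_int n ^ k * x powi n * (zeta_coeff Q m * zeta_coeff Q (n - m))) has_sum P) (UNIV \<times> UNIV)
    \<longleftrightarrow> ((\<lambda>(m, n). of_int (m + n) ^ k * (zeta_coeff Q m * zeta_coeff Q n) * (x powi m * x powi n)) has_sum P) (UNIV \<times> UNIV)"
    by (rule has_sum_reindex_bij_witness[where i = "\<lambda>(m, n). (m + n, m)" and j = "\<lambda>(n, m). (m, n - m)"])
       (use nz in \<open>auto simp: power_int_diff field_simps\<close>)
  hence 1: "((\<lambda>(n, m). of_int n ^ k * x powi n * (zeta_coeff Q m * zeta_coeff Q (n - m))) has_sum P) (UNIV \<times> UNIV)"
    using P by simp
  define c where "c n = (if n = 0 then - K + 1/6 else of_int n * zeta_coeff Q n - 2 * theta_coeff Q n)" for n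
  have "((\<lambda>m. zeta_coeff Q m * zeta_coeff Q (n - m)) has_sum c n) UNIV" for n
    using zeta_coeff_convolution[OF Q, of n] K by (auto simp: c_def)
  hence 2: "((\<lambda>m. case (n, m) of (n, m) \<Rightarrow> of_int n ^ k * x powi n * (zeta_coeff Q m * zeta_coeff Q (n - m)))
      has_sum (of_int n ^ k * x powi n * c n)) UNIV" for n
    by (auto intro: has_sum_cmult_right)
  have 3: "((\<lambda>n. of_int n ^ k * x powi n * c n) has_sum P) UNIV"
    by (rule has_sum_SigmaD[OF 1 2])
  have "((\<lambda>n. if n = 0 then 0 ^ k * - K else 0) has_sum - (if k = 0 then K else 0)) UNIV"
    by (rule has_sum_finite_neutralI[where B = "{0}"]) auto
  from has_sum_add[OF has_sum_add[OF X has_sum_cmult_right[OF M, of "- 2"]] this]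
  have 4: "((\<lambda>n. of_int n ^ k * x powi n * c n) has_sum X + - 2 * M + - (if k = 0 then K else 0)) UNIV"
    by (rule has_sum_cong[THEN iffD1, rotated]) (auto simp: c_def theta_coeff_def algebra_simps power_0_left)
  show ?thesis using has_sum_unique[OF 3 4] by simp
qed

section \<open>Lambert series in the nome\<close>

lemma summable_power_times_geometric:
  fixes x :: "'a :: {real_normed_field, banach}"
  assumes "norm x < 1"
  shows "summable (\<lambda>n. of_nat n ^ j * x ^ n)"
  using assms
proof (induction j arbitrary: x)
  case (Suc j)
  have "summable (\<lambda>n. diffs (\<lambda>n. of_nat n ^ j) n * x ^ n)"
    by (rule termdiff_converges[where K = 1]) (use Suc in auto)
  hence "summable (\<lambda>n. x * (diffs (\<lambda>n. of_nat n ^ j) n * x ^ n))"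
    by (rule summable_mult)
  hence "summable (\<lambda>n. of_nat (Suc n) ^ Suc j * x ^ Suc n)"
    by (rule summable_cong[THEN iffD1, OF always_eventually, rotated]) (simp add: diffs_def mult_ac)
  thus ?case by (subst (asm) summable_Suc_iff)
qed (simp add: summable_geometric)

text \<open>
In this series and the next one the summand at \<open>n = 0\<close> is a quotient by \<open>0\<close>, that is \<open>0\<close>, so that the
summation effectively starts at \<open>n = 1\<close>.
\<close>

definition lambert1 :: "nat \<Rightarrow> nat \<Rightarrow> complex \<Rightarrow> complex" where
  "lambert1 j i q = (\<Sum>n. of_nat n ^ j * (q ^ (i * n) / (1 - q ^ (5 * n))))"

definition lambert2 :: "nat \<Rightarrow> nat \<Rightarrow> complex \<Rightarrow> complex" where
  "lambert2 j i q = (\<Sum>n. of_nat n ^ j * (q ^ (i * n) * q ^ (5 * n) / (1 - q ^ (5 * n)) ^ 2))"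

lemma norm_one_minus_power_ge:
  fixes q :: complex
  assumes "norm q \<le> r" "r < 1" "n > 0"
  shows "1 - r \<le> norm (1 - q ^ n)"
proof -
  have r: "r \<ge> 0" using assms(1) norm_ge_zero[of q] by linarith
  have "norm (q ^ n) \<le> r ^ n" unfolding norm_power by (intro power_mono assms) auto
  also have "r ^ n \<le> r ^ 1" using assms r by (intro power_decreasing) auto
  finally show ?thesis using norm_triangle_ineq2[of 1 "q ^ n"] by simp
qed

lemma lambert_term_bound:
  fixes q :: complex
  assumes "norm q \<le> r" "r < 1" "i > 0"
  shows "norm (of_nat n ^ j * (q ^ (i * n) / (1 - q ^ (5 * n)))) \<le> of_nat n ^ j * r ^ n / (1 - r)"
    and "norm (of_nat n ^ j * (q ^ (i * n) * q ^ (5 * n) / (1 - q ^ (5 * n)) ^ 2)) \<le> of_nat n ^ j * r ^ n / (1 - r) ^ 2"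
proof -
  have r: "r \<ge> 0" using assms(1) norm_ge_zero[of q] by linarith
  have qk: "norm q ^ (k * n) \<le> r ^ n" if "k > 0" for k
  proof -
    have "norm q ^ (k * n) \<le> r ^ (k * n)" by (intro power_mono assms) auto
    also have "\<dots> \<le> r ^ n" using that assms r by (intro power_decreasing) auto
    finally show ?thesis .
  qed
  have q1: "norm q ^ (5 * n) \<le> 1" using assms by (intro power_le_one) auto
  show "norm (of_nat n ^ j * (q ^ (i * n) / (1 - q ^ (5 * n)))) \<le> of_nat n ^ j * r ^ n / (1 - r)"
  proof (cases "n = 0")
    case False
    have "norm (q ^ (i * n)) / norm (1 - q ^ (5 * n)) \<le> r ^ n / (1 - r)"
      using norm_one_minus_power_ge[OF assms(1,2), of "5 * n"] False assms qk r
      by (intro frac_le) (auto simp: norm_power)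
    thus ?thesis
      by (simp add: norm_mult norm_divide norm_power mult_left_mono flip: times_divide_eq_right)
  qed (use assms in auto)
  show "norm (of_nat n ^ j * (q ^ (i * n) * q ^ (5 * n) / (1 - q ^ (5 * n)) ^ 2)) \<le> of_nat n ^ j * r ^ n / (1 - r) ^ 2"
  proof (cases "n = 0")
    case False
    have "norm q ^ (i * n) * norm q ^ (5 * n) \<le> r ^ n * 1"
      using assms r qk q1 by (intro mult_mono) auto
    hence "norm (q ^ (i * n) * q ^ (5 * n)) / norm (1 - q ^ (5 * n)) ^ 2 \<le> r ^ n / (1 - r) ^ 2"
      using norm_one_minus_power_ge[OF assms(1,2), of "5 * n"] False assms r
      by (intro frac_le power_mono) (auto simp: norm_power norm_mult)
    thus ?thesis
      by (simp add: norm_mult norm_divide norm_power mult_left_mono flip: times_divide_eq_right)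
  qed (use assms in auto)
qed

lemma lambert_summable:
  fixes q :: complex
  assumes "norm q < 1" "i > 0"
  shows "summable (\<lambda>n. norm (of_nat n ^ j * (q ^ (i * n) / (1 - q ^ (5 * n)))))"
    and "summable (\<lambda>n. norm (of_nat n ^ j * (q ^ (i * n) * q ^ (5 * n) / (1 - q ^ (5 * n)) ^ 2)))"
proof -
  have s: "summable (\<lambda>n. of_nat n ^ j * norm q ^ n)"
    using assms by (intro summable_power_times_geometric) auto
  show "summable (\<lambda>n. norm (of_nat n ^ j * (q ^ (i * n) / (1 - q ^ (5 * n)))))"
    by (rule summable_comparison_test'[OF summable_divide[OF s, of "1 - norm q"], of 0])
       (use lambert_term_bound(1)[OF order.refl assms] in simp)
  show "summable (\<lambda>n. norm (of_nat n ^ j * (q ^ (i * n) * q ^ (5 * n) / (1 - q ^ (5 * n)) ^ 2)))"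
    by (rule summable_comparison_test'[OF summable_divide[OF s, of "(1 - norm q) ^ 2"], of 0])
       (use lambert_term_bound(2)[OF order.refl assms] in simp)
qed

text \<open>
Termwise differentiation. The operator \<open>q d/dq\<close> acts on \<open>q^(i n)\<close> and on \<open>1 / (1 - q^(5 n))\<close>, and the two
contributions are the series with simple and with double denominators.
\<close>

lemma lambert1_has_derivative:
  assumes q: "norm q < 1" and i: "i > 0"
  obtains D where "(lambert1 j i has_field_derivative D) (at q)"
    and "q * D = of_nat i * lambert1 (Suc j) i q + 5 * lambert2 (Suc j) i q"
    and "q = 0 \<Longrightarrow> j = 0 \<Longrightarrow> D = (if i = 1 then 1 else 0)"
proof -
  define f where "f n x = of_nat n ^ j * (x ^ (i * n) / (1 - x ^ (5 * n)))" for n and x :: complex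
  define f' where "f' n x = of_nat n ^ j * ((of_nat (i * n) * x ^ (i * n - 1) * (1 - x ^ (5 * n))
       + x ^ (i * n) * (of_nat (5 * n) * x ^ (5 * n - 1))) / (1 - x ^ (5 * n)) ^ 2)" for n and x :: complex
  have ne: "x ^ (5 * n) \<noteq> 1" if "norm x < 1" "n > 0" for x :: complex and n
  proof
    assume "x ^ (5 * n) = 1"
    thus False using norm_one_minus_power_ge[of x "norm x" "5 * n"] that by auto
  qed
  have "\<exists>g g'. \<forall>x \<in> ball 0 1. ((\<lambda>n. f n x) sums g x) \<and> ((\<lambda>n. f' n x) sums g' x) \<and> (g has_field_derivative g' x) (at x)"
  proof (rule series_and_derivative_comparison_local)
    show "(f n has_field_derivative f' n x) (at x)" if "x \<in> ball 0 1" for n x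
    proof (cases "n = 0")
      case True
      thus ?thesis by (simp add: f_def [abs_def] f'_def)
    next
      case False
      show ?thesis unfolding f_def [abs_def] f'_def
        using ne[of x n] that False
        by (auto intro!: derivative_eq_intros simp: power2_eq_square field_simps)
    qed
    show "\<exists>d h. 0 < d \<and> summable h \<and> (\<forall>\<^sub>F n in sequentially. \<forall>y\<in>ball x d \<inter> ball 0 1. norm (f n y) \<le> h n)"
      if "x \<in> ball 0 1" for x
    proof -
      define r where "r = (norm x + 1) / 2"
      have r: "norm x < r" "r < 1" "0 \<le> r" using that by (auto simp: r_def)
      have "norm (f n y) \<le> of_nat n ^ j * r ^ n / (1 - r)" if "y \<in> ball x (r - norm x)" for n y
      proof -
        have "norm y \<le> r" using that norm_triangle_ineq2[of y x] by (simp add: dist_norm norm_minus_commute)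
        thus ?thesis unfolding f_def using r i by (intro lambert_term_bound) auto
      qed
      moreover have "summable (\<lambda>n. of_nat n ^ j * r ^ n / (1 - r))"
        using r by (intro summable_divide summable_power_times_geometric) auto
      ultimately show ?thesis using r
        by (intro exI[of _ "r - norm x"] exI[of _ "\<lambda>n. of_nat n ^ j * r ^ n / (1 - r)"]) auto
    qed
  qed auto
  then obtain g g' where gg: "\<forall>x\<in>ball 0 1. (\<lambda>n. f n x) sums g x \<and> (\<lambda>n. f' n x) sums g' x
      \<and> (g has_field_derivative g' x) (at x)" by blast
  have g: "(\<lambda>n. f n x) sums g x" "(\<lambda>n. f' n x) sums g' x" "(g has_field_derivative g' x) (at x)"
    if "norm x < 1" for x
    using gg that by auto
  have eq: "g x = lambert1 j i x" if "norm x < 1" for x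
    using g(1)[OF that] by (simp add: sums_iff lambert1_def f_def)
  have 1: "(lambert1 j i has_field_derivative g' q) (at q)"
    by (rule has_field_derivative_transform_within_open[OF g(3)[OF q], of "ball 0 1"]) (use eq q in auto)
  have "(\<lambda>n. of_nat i * (of_nat n ^ Suc j * (q ^ (i * n) / (1 - q ^ (5 * n))))
      + 5 * (of_nat n ^ Suc j * (q ^ (i * n) * q ^ (5 * n) / (1 - q ^ (5 * n)) ^ 2)))
      sums (of_nat i * lambert1 (Suc j) i q + 5 * lambert2 (Suc j) i q)"
    unfolding lambert1_def lambert2_def
    by (intro sums_add sums_mult summable_sums summable_norm_cancel[OF lambert_summable(1)]
          summable_norm_cancel[OF lambert_summable(2)] q i)
  moreover have "of_nat i * (of_nat n ^ Suc j * (q ^ (i * n) / (1 - q ^ (5 * n))))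
      + 5 * (of_nat n ^ Suc j * (q ^ (i * n) * q ^ (5 * n) / (1 - q ^ (5 * n)) ^ 2)) = q * f' n q" for n
  proof (cases "n = 0")
    case False
    have gen: "N * ((I * M * X * u + X * (5 * M * Y)) / u ^ 2)
        = I * (M * N * (X / u)) + 5 * (M * N * (X * Y / u ^ 2))" if "u \<noteq> 0" for u N I M X Y :: complex
      using that by (simp add: field_simps power2_eq_square)
    have p: "q * q ^ (k * n - 1) = q ^ (k * n)" if "k > 0" for k
      using that False by (metis mult_pos_pos neq0_conv power_minus_mult mult.commute)
    have "q * f' n q = of_nat n ^ j * ((of_nat (i * n) * (q * q ^ (i * n - 1)) * (1 - q ^ (5 * n))
       + q ^ (i * n) * (of_nat (5 * n) * (q * q ^ (5 * n - 1)))) / (1 - q ^ (5 * n)) ^ 2)"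
      by (simp add: f'_def algebra_simps)
    also have "\<dots> = of_nat n ^ j * ((of_nat (i * n) * q ^ (i * n) * (1 - q ^ (5 * n))
       + q ^ (i * n) * (of_nat (5 * n) * q ^ (5 * n))) / (1 - q ^ (5 * n)) ^ 2)"
      using i by (simp only: p zero_less_numeral)
    also have "\<dots> = of_nat i * (of_nat n ^ Suc j * (q ^ (i * n) / (1 - q ^ (5 * n))))
      + 5 * (of_nat n ^ Suc j * (q ^ (i * n) * q ^ (5 * n) / (1 - q ^ (5 * n)) ^ 2))"
      using gen[of "1 - q ^ (5 * n)" "of_nat n ^ j" "of_nat i" "of_nat n" "q ^ (i * n)" "q ^ (5 * n)"]
        ne[OF q, of n] False by (simp add: mult_ac)
    finally show ?thesis by simp
  qed (simp add: f'_def)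
  ultimately have "(\<lambda>n. q * f' n q) sums (of_nat i * lambert1 (Suc j) i q + 5 * lambert2 (Suc j) i q)" by simp
  moreover have "(\<lambda>n. q * f' n q) sums (q * g' q)" by (intro sums_mult g q)
  ultimately have 2: "q * g' q = of_nat i * lambert1 (Suc j) i q + 5 * lambert2 (Suc j) i q"
    using sums_unique2 by blast
  have 3: "g' q = (if i = 1 then 1 else 0)" if "q = 0" "j = 0"
  proof -
    have small: "i * n \<le> Suc 0 \<longleftrightarrow> n = 0 \<or> i = 1 \<and> n = 1" for n
      using i by (auto simp: le_Suc_eq)
    have "f' n q = (if n = 1 then if i = 1 then 1 else 0 else 0)" for n
      using that i small by (cases "n = 0"; cases "n = 1"; cases "i = 1") (auto simp: f'_def power_0_left)
    hence "(\<lambda>n. f' n q) sums (if i = 1 then 1 else 0)"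
      using sums_single[of 1 "\<lambda>_. if i = 1 then 1 else 0 :: complex"] by simp
    thus ?thesis using g(2)[OF q] sums_unique2 by blast
  qed
  show ?thesis using that[OF 1 2 3] by blast
qed

lemma lambert1_0 [simp]: "i > 0 \<Longrightarrow> lambert1 j i 0 = 0"
proof -
  assume "i > 0"
  hence "(\<lambda>n. of_nat n ^ j * (0 ^ (i * n) / (1 - 0 ^ (5 * n))) :: complex) = (\<lambda>n. 0)"
    by (auto simp: fun_eq_iff power_0_left)
  thus ?thesis by (simp add: lambert1_def)
qed

section \<open>Values at the points of order five\<close>

text \<open>
The \<open>j\<close>-th derivative of \<open>J\<close> under \<open>x d/dx\<close>, at \<open>x = q^i\<close> for the nome \<open>q^5\<close>, in a form that makes sense at
\<open>q = 0\<close> as well: the summands of the Laurent series with negative exponents are folded onto positive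
ones, which replaces \<open>i\<close> by \<open>5 - i\<close>. The identification is \<open>zeta_ser_has_sum\<close>.
\<close>

definition zeta_ser :: "nat \<Rightarrow> nat \<Rightarrow> complex \<Rightarrow> complex" where
  "zeta_ser j i q = (if j = 0 then 1 / 2 else 0) + lambert1 j i q - (- 1) ^ j * lambert1 j (5 - i) q"

text \<open>
The same for \<open>H\<close>. Folding produces an additional series with simple denominators, because
\<open>theta_coeff Q n * Q powi (- n) = theta_coeff Q n + zeta_coeff Q n\<close> for \<open>n \<noteq> 0\<close>.
\<close>

definition theta_ser :: "nat \<Rightarrow> nat \<Rightarrow> complex \<Rightarrow> complex" where
  "theta_ser j i q = (if j = 0 then - 1 / 12 else 0) + lambert2 j i q
     + (- 1) ^ j * (lambert2 j (5 - i) q + lambert1 j (5 - i) q)"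

lemma has_sum_int:
  fixes f :: "int \<Rightarrow> 'a :: {topological_comm_monoid_add, t2_space}"
  assumes "((\<lambda>n. f (int n)) has_sum A) {1..}" "((\<lambda>n. f (- int n)) has_sum B) {1..}"
  shows "(f has_sum (f 0 + A + B)) UNIV"
proof -
  have 1: "(f has_sum A) {1..}"
    using assms(1) by (subst has_sum_reindex_bij_witness[where i = int and j = nat and T = "{1..}"]) auto
  have 2: "(f has_sum B) {..-1}"
    using assms(2) by (subst has_sum_reindex_bij_witness[where i = "\<lambda>n. - int n" and j = "\<lambda>n. nat (- n)" and T = "{1..}"]) auto
  have "(f has_sum (f 0 + (A + B))) (insert 0 ({1..} \<union> {..-1}))"
    by (intro has_sum_insert has_sum_Un_disjoint 1 2) auto
  moreover have "insert 0 ({1..} \<union> {..-1}) = (UNIV :: int set)" by auto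
  ultimately show ?thesis by (simp add: add.assoc)
qed

lemma lambert_has_sum:
  assumes q: "norm q < 1" and i: "i > 0"
  shows "((\<lambda>n. of_nat n ^ j * (q ^ (i * n) / (1 - q ^ (5 * n)))) has_sum lambert1 j i q) {1..}"
    and "((\<lambda>n. of_nat n ^ j * (q ^ (i * n) * q ^ (5 * n) / (1 - q ^ (5 * n)) ^ 2)) has_sum lambert2 j i q) {1..}"
proof -
  note s = lambert_summable[OF q i]
  show "((\<lambda>n. of_nat n ^ j * (q ^ (i * n) / (1 - q ^ (5 * n)))) has_sum lambert1 j i q) {1..}"
    using norm_summable_imp_has_sum[OF s(1) summable_sums[OF summable_norm_cancel[OF s(1)]]]
    unfolding lambert1_def by (rule has_sum_cong_neutral[THEN iffD1, rotated -1]) (auto simp: not_le)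
  show "((\<lambda>n. of_nat n ^ j * (q ^ (i * n) * q ^ (5 * n) / (1 - q ^ (5 * n)) ^ 2)) has_sum lambert2 j i q) {1..}"
    using norm_summable_imp_has_sum[OF s(2) summable_sums[OF summable_norm_cancel[OF s(2)]]]
    unfolding lambert2_def by (rule has_sum_cong_neutral[THEN iffD1, rotated -1]) (auto simp: not_le)
qed

lemma zeta_ser_has_sum:
  assumes q: "0 < norm q" "norm q < 1" and i: "i > 0" "i < 5"
  shows "((\<lambda>n. of_int n ^ j * zeta_coeff (q ^ 5) n * (q ^ i) powi n) has_sum zeta_ser j i q) UNIV"
    and "((\<lambda>n. of_int n ^ j * theta_coeff (q ^ 5) n * (q ^ i) powi n) has_sum theta_ser j i q) UNIV"
proof -
  have Q: "0 < norm (q ^ 5)" "norm (q ^ 5) < 1"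
    using q by (auto simp: norm_power power_less_one_iff)
  have q0: "q \<noteq> 0" using q by auto
  have ne: "q ^ (5 * n) \<noteq> 1" if "n > 0" for n
    using powi_neq_1[OF Q, of "int n"] that by (simp add: power_mult)
  have identity: "(1 - u) / u ^ 2 + 1 / u = 1 / u ^ 2" if "u \<noteq> 0" for u :: complex
    using that by (simp add: field_simps power2_eq_square)
  have pos: "zeta_coeff (q ^ 5) (int n) = 1 / (1 - q ^ (5 * n))" if "n > 0" for n
    using that by (simp add: zeta_coeff_def power_mult)
  have neg: "zeta_coeff (q ^ 5) (- int n) = - (q ^ (5 * n) / (1 - q ^ (5 * n)))" if "n > 0" for n
    using ne[OF that] that by (simp add: zeta_coeff_minus[OF Q] pos field_simps)
  have mpos: "theta_coeff (q ^ 5) (int n) = q ^ (5 * n) / (1 - q ^ (5 * n)) ^ 2" if "n > 0" for n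
    using identity[of "1 - q ^ (5 * n)"] ne[OF that] that
    by (simp add: theta_coeff_def pos power_one_over algebra_simps)
  have pw: "(q ^ i) powi int n = q ^ (i * n)" for n by (simp add: power_mult)
  have pw': "(q ^ i) powi (- int n) = q ^ ((5 - i) * n) / q ^ (5 * n)" for n
  proof -
    have "(5 - i) * n + i * n = 5 * n" using i by (simp add: algebra_simps diff_mult_distrib)
    hence "q ^ ((5 - i) * n) * q ^ (i * n) = q ^ (5 * n)" by (simp flip: power_add)
    thus ?thesis using q0 by (simp add: power_int_minus power_mult[symmetric] field_simps)
  qed
  have i': "5 - i > 0" using i by auto
  note h = lambert_has_sum[OF q(2) i(1), of j] lambert_has_sum[OF q(2) i', of j]
  let ?f = "\<lambda>n. of_int n ^ j * zeta_coeff (q ^ 5) n * (q ^ i) powi n"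
  let ?g = "\<lambda>n. of_int n ^ j * theta_coeff (q ^ 5) n * (q ^ i) powi n"
  have "((\<lambda>n. ?f (int n)) has_sum lambert1 j i q) {1..}"
    using h(1) by (rule has_sum_cong[THEN iffD1, rotated]) (simp add: pos flip: power_mult)
  moreover have "((\<lambda>n. ?f (- int n)) has_sum (- ((- 1) ^ j) * lambert1 j (5 - i) q)) {1..}"
    using has_sum_cmult_right[OF h(3), of "- ((- 1) ^ j)"]
    by (rule has_sum_cong[THEN iffD1, rotated]) (use q0 in \<open>simp add: neg pw' power_minus[of "of_nat _"]\<close>)
  ultimately have "(?f has_sum (?f 0 + lambert1 j i q + - ((- 1) ^ j) * lambert1 j (5 - i) q)) UNIV"
    by (rule has_sum_int)
  thus "(?f has_sum zeta_ser j i q) UNIV"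
    by (cases "j = 0") (simp_all add: zeta_ser_def zeta_coeff_def power_0_left)
  have "((\<lambda>n. ?g (int n)) has_sum lambert2 j i q) {1..}"
    using h(2) by (rule has_sum_cong[THEN iffD1, rotated]) (simp add: mpos flip: power_mult)
  moreover have "((\<lambda>n. ?g (- int n)) has_sum (- 1) ^ j * (lambert2 j (5 - i) q + lambert1 j (5 - i) q)) {1..}"
  proof (rule has_sum_cong[THEN iffD1, OF _ has_sum_cmult_right[OF has_sum_add[OF h(4) h(3)]]])
    show "(- 1) ^ j * (of_nat n ^ j * (q ^ ((5 - i) * n) * q ^ (5 * n) / (1 - q ^ (5 * n)) ^ 2)
        + of_nat n ^ j * (q ^ ((5 - i) * n) / (1 - q ^ (5 * n)))) = ?g (- int n)" if "n \<in> {1..}" for n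
    proof -
      have "q ^ (5 * n) / (1 - q ^ (5 * n)) ^ 2 + 1 / (1 - q ^ (5 * n)) = 1 / (1 - q ^ (5 * n)) ^ 2"
        using identity[of "1 - q ^ (5 * n)"] ne[of n] that by simp
      hence *: "q ^ ((5 - i) * n) * (q ^ (5 * n) / (1 - q ^ (5 * n)) ^ 2 + 1 / (1 - q ^ (5 * n)))
         = q ^ ((5 - i) * n) / (1 - q ^ (5 * n)) ^ 2" by simp
      have "(- 1) ^ j * (of_nat n ^ j * (q ^ ((5 - i) * n) * q ^ (5 * n) / (1 - q ^ (5 * n)) ^ 2)
        + of_nat n ^ j * (q ^ ((5 - i) * n) / (1 - q ^ (5 * n))))
        = (- 1) ^ j * (of_nat n ^ j * (q ^ ((5 - i) * n) * (q ^ (5 * n) / (1 - q ^ (5 * n)) ^ 2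
            + 1 / (1 - q ^ (5 * n)))))"
        by (simp only: distrib_left times_divide_eq_right mult_1_right)
      also have "\<dots> = ?g (- int n)"
        unfolding * using that q0 by (simp add: theta_coeff_minus[OF Q] mpos pw' power_minus[of "of_nat _"])
      finally show ?thesis .
    qed
  qed
  ultimately have "(?g has_sum (?g 0 + lambert2 j i q + (- 1) ^ j * (lambert2 j (5 - i) q + lambert1 j (5 - i) q))) UNIV"
    by (rule has_sum_int)
  thus "(?g has_sum theta_ser j i q) UNIV"
    by (cases "j = 0") (simp_all add: theta_ser_def theta_coeff_def power_0_left)
qed

text \<open>
The chain rule for moving \<open>x = q^i\<close> and \<open>Q = q^5\<close> simultaneously: the \<open>Q\<close>-derivative of \<open>J\<close> is the
\<open>x\<close>-derivative of \<open>H\<close>, since both are second derivatives of \<open>- log \<phi>\<close>.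
\<close>

lemma zeta_ser_has_derivative:
  assumes q: "norm q < 1" and i: "i > 0" "i < 5"
  obtains D where "(zeta_ser j i has_field_derivative D) (at q)"
    and "q * D = of_nat i * zeta_ser (Suc j) i q + 5 * theta_ser (Suc j) i q"
    and "q = 0 \<Longrightarrow> j = 0 \<Longrightarrow> D = (if i = 1 then 1 else if i = 4 then -1 else 0)"
proof -
  have i': "5 - i > 0" using i by auto
  obtain D1 where D1: "(lambert1 j i has_field_derivative D1) (at q)"
    "q * D1 = of_nat i * lambert1 (Suc j) i q + 5 * lambert2 (Suc j) i q"
    "q = 0 \<Longrightarrow> j = 0 \<Longrightarrow> D1 = (if i = 1 then 1 else 0)"
    using lambert1_has_derivative[OF q i(1)] by blast
  obtain D2 where D2: "(lambert1 j (5 - i) has_field_derivative D2) (at q)"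
    "q * D2 = of_nat (5 - i) * lambert1 (Suc j) (5 - i) q + 5 * lambert2 (Suc j) (5 - i) q"
    "q = 0 \<Longrightarrow> j = 0 \<Longrightarrow> D2 = (if 5 - i = 1 then 1 else 0)"
    using lambert1_has_derivative[OF q i'] by blast
  have "(zeta_ser j i has_field_derivative D1 - (- 1) ^ j * D2) (at q)"
    using DERIV_diff[OF DERIV_add[OF DERIV_const D1(1)] DERIV_cmult[OF D2(1), of "(- 1) ^ j"],
        of "if j = 0 then 1 / 2 else 0"]
    by (simp add: zeta_ser_def [abs_def])
  moreover have "q * (D1 - (- 1) ^ j * D2) = of_nat i * zeta_ser (Suc j) i q + 5 * theta_ser (Suc j) i q"
  proof -
    have "q * (D1 - (- 1) ^ j * D2) = q * D1 - (- 1) ^ j * (q * D2)"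
      by (simp add: algebra_simps)
    also have "\<dots> = of_nat i * zeta_ser (Suc j) i q + 5 * theta_ser (Suc j) i q"
      unfolding D1(2) D2(2) using i by (simp add: zeta_ser_def theta_ser_def of_nat_diff algebra_simps)
    finally show ?thesis .
  qed
  moreover have "D1 - (- 1) ^ j * D2 = (if i = 1 then 1 else if i = 4 then -1 else 0)" if "q = 0" "j = 0"
    using D1(3) D2(3) that i by auto
  ultimately show ?thesis using that by blast
qed

text \<open>
The addition theorem at \<open>x = q^i\<close> and \<open>y = q^l\<close>. The bound on \<open>i + l\<close> keeps the product \<open>xy\<close> in the annulus
of convergence.
\<close>

lemma
  assumes q: "0 < norm q" "norm q < 1" and i: "0 < i" "0 < l" "i + l < 5"
  shows three_term_0: "zeta_ser 0 i q * zeta_ser 0 l q - zeta_ser 0 (i + l) q * (zeta_ser 0 i q + zeta_ser 0 l q)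
          = theta_ser 0 i q + theta_ser 0 l q + theta_ser 0 (i + l) q"
    and three_term_1: "zeta_ser 1 i q * zeta_ser 0 l q - zeta_ser 0 i q * zeta_ser 1 l q
            - zeta_ser 0 (i + l) q * (zeta_ser 1 i q - zeta_ser 1 l q) = theta_ser 1 i q - theta_ser 1 l q"
    and three_term_2: "zeta_ser 2 i q * zeta_ser 0 l q - 2 * zeta_ser 1 i q * zeta_ser 1 l q + zeta_ser 0 i q * zeta_ser 2 l q
            - zeta_ser 0 (i + l) q * (zeta_ser 2 i q + zeta_ser 2 l q) = theta_ser 2 i q + theta_ser 2 l q"
proof -
  have Q: "0 < norm (q ^ 5)" "norm (q ^ 5) < 1"
    using q by (auto simp: norm_power power_less_one_iff)
  have x: "q ^ i \<noteq> 0" "q ^ l \<noteq> 0" using q by auto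
  have b: "i < 5" "l < 5" using i by auto
  have W: "((\<lambda>n. zeta_coeff (q ^ 5) n * (q ^ i * q ^ l) powi n) has_sum zeta_ser 0 (i + l) q) UNIV"
    "((\<lambda>n. theta_coeff (q ^ 5) n * (q ^ i * q ^ l) powi n) has_sum theta_ser 0 (i + l) q) UNIV"
    using zeta_ser_has_sum[OF q, of "i + l" 0] i by (auto simp: power_add)
  note main = three_term_identity_weighted[OF Q x zeta_ser_has_sum(1)[OF q i(1) b(1)] zeta_ser_has_sum(1)[OF q i(2) b(2)]
      W(1) zeta_ser_has_sum(2)[OF q i(1) b(1)] zeta_ser_has_sum(2)[OF q i(2) b(2)] W(2)]
  note P = zeta_product_has_sum[OF zeta_ser_has_sum(1)[OF q i(1) b(1)] zeta_ser_has_sum(1)[OF q i(2) b(2)]]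
  show "zeta_ser 0 i q * zeta_ser 0 l q - zeta_ser 0 (i + l) q * (zeta_ser 0 i q + zeta_ser 0 l q)
          = theta_ser 0 i q + theta_ser 0 l q + theta_ser 0 (i + l) q"
    using main[of 0 "zeta_ser 0 i q * zeta_ser 0 l q"] P[of 0 0] by simp
  have "((\<lambda>(m, n). of_int (m - n) ^ 1 * (zeta_coeff (q ^ 5) m * zeta_coeff (q ^ 5) n) * ((q ^ i) powi m * (q ^ l) powi n))
      has_sum (zeta_ser 1 i q * zeta_ser 0 l q + - (zeta_ser 0 i q * zeta_ser 1 l q))) UNIV"
    using has_sum_add[OF P[of 1 0] has_sum_uminusI[OF P[of 0 1]]]
    by (rule has_sum_cong[THEN iffD1, rotated]) (auto simp: algebra_simps)
  from main[OF this] show "zeta_ser 1 i q * zeta_ser 0 l q - zeta_ser 0 i q * zeta_ser 1 l q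
            - zeta_ser 0 (i + l) q * (zeta_ser 1 i q - zeta_ser 1 l q) = theta_ser 1 i q - theta_ser 1 l q"
    by (simp add: algebra_simps)
  have "((\<lambda>(m, n). of_int (m - n) ^ 2 * (zeta_coeff (q ^ 5) m * zeta_coeff (q ^ 5) n) * ((q ^ i) powi m * (q ^ l) powi n))
      has_sum (zeta_ser 2 i q * zeta_ser 0 l q + - 2 * (zeta_ser 1 i q * zeta_ser 1 l q) + zeta_ser 0 i q * zeta_ser 2 l q)) UNIV"
    using has_sum_add[OF has_sum_add[OF P[of 2 0] has_sum_cmult_right[OF P[of 1 1], of "- 2"]] P[of 0 2]]
    by (rule has_sum_cong[THEN iffD1, rotated]) (auto simp: algebra_simps power2_eq_square)
  from main[OF this] show "zeta_ser 2 i q * zeta_ser 0 l q - 2 * zeta_ser 1 i q * zeta_ser 1 l q + zeta_ser 0 i q * zeta_ser 2 l q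
            - zeta_ser 0 (i + l) q * (zeta_ser 2 i q + zeta_ser 2 l q) = theta_ser 2 i q + theta_ser 2 l q"
    by (simp add: algebra_simps)
qed

text \<open>
The heat equation and its \<open>x\<close>-derivative at all points of order five; what matters is that the
constant \<open>K\<close> does not depend on \<open>i\<close>.
\<close>

lemma heat_equations:
  assumes q: "0 < norm q" "norm q < 1"
  obtains K where "\<And>i. 0 < i \<Longrightarrow> i < 5 \<Longrightarrow> zeta_ser 1 i q = zeta_ser 0 i q ^ 2 + 2 * theta_ser 0 i q + K"
    and "\<And>i. 0 < i \<Longrightarrow> i < 5 \<Longrightarrow> zeta_ser 2 i q = 2 * zeta_ser 0 i q * zeta_ser 1 i q + 2 * theta_ser 1 i q"
proof -
  have Q: "0 < norm (q ^ 5)" "norm (q ^ 5) < 1"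
    using q by (auto simp: norm_power power_less_one_iff)
  note T = zeta_ser_has_sum(1)[OF q] and U = zeta_ser_has_sum(2)[OF q]
  note P = zeta_product_has_sum[OF T T]
  have "(\<lambda>m. zeta_coeff (q ^ 5) m * zeta_coeff (q ^ 5) (- m)) summable_on UNIV"
  proof -
    have "(\<lambda>(n, m). q powi n * (zeta_coeff (q ^ 5) m * zeta_coeff (q ^ 5) (n - m))) summable_on (UNIV \<times> UNIV)
    \<longleftrightarrow> (\<lambda>(m, n). (zeta_coeff (q ^ 5) m * zeta_coeff (q ^ 5) n) * (q powi m * q powi n)) summable_on (UNIV \<times> UNIV)"
      by (rule summable_on_reindex_bij_witness[where i = "\<lambda>(m, n). (m + n, m)" and j = "\<lambda>(n, m). (m, n - m)"])
         (use q in \<open>auto simp: power_int_diff field_simps\<close>)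
    moreover have "(\<lambda>(m, n). (zeta_coeff (q ^ 5) m * zeta_coeff (q ^ 5) n) * (q powi m * q powi n)) summable_on (UNIV \<times> UNIV)"
      using has_sum_imp_summable[OF P[of 1 1 0 0]] by simp
    ultimately have "(\<lambda>(n, m). q powi n * (zeta_coeff (q ^ 5) m * zeta_coeff (q ^ 5) (n - m))) summable_on (UNIV \<times> UNIV)"
      by blast
    from summable_on_SigmaD1[OF this, of 0] show ?thesis by simp
  qed
  then obtain s where s: "((\<lambda>m. zeta_coeff (q ^ 5) m * zeta_coeff (q ^ 5) (- m)) has_sum s) UNIV"
    by (auto simp: summable_on_def)
  \<comment> \<open>The convolution sum \<open>s\<close> is the constant term of \<open>J(x)^2\<close>, which is the same for every \<open>x\<close>.\<close>
  define K where "K = 1 / 6 - s"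
  have K: "((\<lambda>m. zeta_coeff (q ^ 5) m * zeta_coeff (q ^ 5) (- m)) has_sum - K + 1 / 6) UNIV"
    using s by (simp add: K_def)
  have nz: "q ^ i \<noteq> 0" for i using q by auto
  show ?thesis
  proof (rule that)
    fix i :: nat assume i: "0 < i" "i < 5"
    have "((\<lambda>n. of_int n ^ Suc 0 * zeta_coeff (q ^ 5) n * (q ^ i) powi n) has_sum zeta_ser 1 i q) UNIV"
      using T[OF i, of 1] by simp
    from heat_equation_weighted[OF Q nz this U[OF i] _ K, of "zeta_ser 0 i q ^ 2"]
    show "zeta_ser 1 i q = zeta_ser 0 i q ^ 2 + 2 * theta_ser 0 i q + K"
      using P[OF i i, of 0 0] by (simp add: power2_eq_square)
    have T2: "((\<lambda>n. of_int n ^ Suc 1 * zeta_coeff (q ^ 5) n * (q ^ i) powi n) has_sum zeta_ser 2 i q) UNIV"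
      using T[OF i, of 2] by (simp add: numeral_2_eq_2)
    have "((\<lambda>(m, n). of_int (m + n) ^ 1 * (zeta_coeff (q ^ 5) m * zeta_coeff (q ^ 5) n) * ((q ^ i) powi m * (q ^ i) powi n))
      has_sum (zeta_ser 1 i q * zeta_ser 0 i q + zeta_ser 0 i q * zeta_ser 1 i q)) UNIV"
      using has_sum_add[OF P[OF i i, of 1 0] P[OF i i, of 0 1]]
      by (rule has_sum_cong[THEN iffD1, rotated]) (auto simp: algebra_simps)
    from heat_equation_weighted[OF Q nz T2 U[OF i] this K]
    show "zeta_ser 2 i q = 2 * zeta_ser 0 i q * zeta_ser 1 i q + 2 * theta_ser 1 i q"
      by (simp add: algebra_simps)
  qed
qed

text \<open>
The symmetry of \<open>\<phi>\<close> under \<open>x \<mapsto> Q / x\<close>, which exchanges \<open>q^i\<close> and \<open>q^(5 - i)\<close>.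
\<close>

lemma reflections:
  "zeta_ser 0 4 q = 1 - zeta_ser 0 1 q" "zeta_ser 0 3 q = 1 - zeta_ser 0 2 q"
  "zeta_ser 1 3 q = zeta_ser 1 2 q"
  "theta_ser 0 4 q = theta_ser 0 1 q + zeta_ser 0 1 q - 1 / 2"
  "theta_ser 1 3 q = - (theta_ser 1 2 q + zeta_ser 1 2 q)"
  by (simp_all add: zeta_ser_def theta_ser_def)

section \<open>Modular forms of level five\<close>

text \<open>
Subtracting \<open>1/5\<close> and \<open>2/5\<close> makes \<open>J(q)\<close> and \<open>J(q^2)\<close> modular of weight one. The combinations here are the
ones that divide their own derivatives under \<open>q d/dq\<close>; \<open>form_a\<close> is \<open>1 + O(q)\<close> and \<open>form_b\<close> is \<open>q + O(q^2)\<close>.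
\<close>

definition form_a :: "complex \<Rightarrow> complex" where
  "form_a q = 3 * zeta_ser 0 1 q + zeta_ser 0 2 q - 1"

definition form_b :: "complex \<Rightarrow> complex" where
  "form_b q = zeta_ser 0 1 q - 3 * zeta_ser 0 2 q + 1"

text \<open>
Minus the logarithmic derivative of \<open>form_e\<close> under \<open>q d/dq\<close>, expressed through the derivative of \<open>J\<close> at \<open>q\<close>.
\<close>

definition form_r :: "complex \<Rightarrow> complex" where
  "form_r q = 10 * zeta_ser 1 1 q - 5 * form_a q * form_b q"

text \<open>
For \<open>q = nome \<tau>\<close> this is the quotient \<open>\<eta>(\<tau>)^5 / \<eta>(5\<tau>)\<close> of Dedekind eta functions.
\<close>

definition form_e :: "complex \<Rightarrow> complex" where
  "form_e q = form_a q ^ 2 - 11 * form_a q * form_b q - form_b q ^ 2"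

text \<open>
The elimination behind the differential system. Here \<open>J\<^sub>1, H\<^sub>1, T\<^sub>1, V\<^sub>1\<close> are the values of \<open>J\<close>, \<open>H\<close> and of their
first derivatives at \<open>q\<close>, the index \<open>2\<close> refers to \<open>q^2\<close>, and \<open>TT\<close>, \<open>UU\<close> are the second derivatives at \<open>q\<close>. The
hypotheses are instances of the addition theorem (\<open>A\<close>, \<open>B\<close>, \<open>C\<close>) and of the heat equation, with the points
\<open>q^3\<close> and \<open>q^4\<close> already reflected to \<open>q^2\<close> and \<open>q\<close>. Each group is linear in the quantities of the next
level: \<open>A\<close> yields \<open>H\<close>, then the heat equation yields \<open>T\<^sub>1 - T\<^sub>2\<close>, \<open>B\<close> yields \<open>V\<close>, and \<open>C\<close> yields \<open>UU\<close>.
\<close>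

lemma level_five_algebra:
  fixes J1 J2 H1 H2 T1 T2 V1 V2 TT UU K a b R :: complex
  assumes A: "J1 * J1 - J2 * (J1 + J1) = H1 + H1 + H2"
    "J2 * J2 - (1 - J1) * (J2 + J2) = H2 + H2 + (H1 + J1 - 1 / 2)"
    and B: "T1 * J2 - J1 * T2 - (1 - J2) * (T1 - T2) = V1 - V2"
    "T1 * (1 - J2) - J1 * T2 - (1 - J1) * (T1 - T2) = V1 + (V2 + T2)"
    and C: "TT * J1 - 2 * T1 * T1 + J1 * TT - J2 * (TT + TT) = UU + UU"
    and T: "T1 = J1 ^ 2 + 2 * H1 + K" "T2 = J2 ^ 2 + 2 * H2 + K"
    and TT: "TT = 2 * J1 * T1 + 2 * V1"
    and ab: "a = 3 * J1 + J2 - 1" "b = J1 - 3 * J2 + 1"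
    and R: "R = 10 * T1 - 5 * a * b"
  shows "300 * H1 = 66 * a * b - a ^ 2 + 11 * b ^ 2 - 18 * a - 6 * b - 6"
    and "300 * H2 = 11 * a ^ 2 - 66 * a * b - b ^ 2 - 12 * a + 36 * b - 24"
    and "20 * (T1 + 5 * V1) = 5 * a * b * (7 * a - b) - R * (3 * a + b)"
    and "20 * (2 * T2 + 5 * V2) = 5 * a * b * (a + 7 * b) - R * (a - 3 * b)"
    and "20 * (TT + 5 * UU) = 20 * a ^ 3 * b + 15 * a ^ 2 * b ^ 2 - 10 * a * b * R - R ^ 2"
proof -
  have J1: "J1 = (3 * a + b + 2) / 10" and J2: "J2 = (a - 3 * b + 4) / 10"
    by (simp_all add: ab)
  show h1: "300 * H1 = 66 * a * b - a ^ 2 + 11 * b ^ 2 - 18 * a - 6 * b - 6"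
    using A ab by algebra
  show h2: "300 * H2 = 11 * a ^ 2 - 66 * a * b - b ^ 2 - 12 * a + 36 * b - 24"
    using A ab by algebra
  have t1: "T1 = (R + 5 * a * b) / 10"
    by (simp add: R)
  have "300 * T1 - 300 * T2 = 300 * J1 ^ 2 - 300 * J2 ^ 2 + 2 * (300 * H1) - 2 * (300 * H2)"
    unfolding T by simp
  also have "\<dots> = 300 * (a * b)"
    unfolding h1 h2 J1 J2 by (simp add: field_simps power2_eq_square)
  finally have "300 * (T1 - T2) = 300 * (a * b)" by (simp only: right_diff_distrib)
  hence "T1 - T2 = a * b" by (subst (asm) mult_cancel_left) simp
  hence t2: "T2 = (R - 5 * a * b) / 10"
    unfolding t1 by (simp add: field_simps)
  have v1: "2 * V1 = (T1 * J2 - J1 * T2 - (1 - J2) * (T1 - T2)) + (T1 * (1 - J2) - J1 * T2 - (1 - J1) * (T1 - T2)) - T2"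
    unfolding B by simp
  have v2: "V2 = V1 - (T1 * J2 - J1 * T2 - (1 - J2) * (T1 - T2))"
    unfolding B by simp
  have "100 * V1 = 50 * (2 * V1)" by simp
  also have "\<dots> = 5 * a * b * (7 * a - b) - R * (3 * a + b) - 2 * R - 10 * a * b"
    unfolding v1 t1 t2 J1 J2 by (simp add: field_simps power2_eq_square)
  finally have V1: "100 * V1 = 5 * a * b * (7 * a - b) - R * (3 * a + b) - 2 * R - 10 * a * b" .
  have "100 * V2 = 100 * V1 - 100 * (T1 * J2 - J1 * T2 - (1 - J2) * (T1 - T2))"
    unfolding v2 by (simp add: algebra_simps)
  also have "\<dots> = 5 * a * b * (a + 7 * b) - R * (a - 3 * b) - 4 * R + 20 * a * b"
    unfolding V1 t1 t2 J1 J2 by (simp add: field_simps power2_eq_square)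
  finally have V2: "100 * V2 = 5 * a * b * (a + 7 * b) - R * (a - 3 * b) - 4 * R + 20 * a * b" .
  have "20 * (T1 + 5 * V1) = 20 * T1 + 100 * V1" by simp
  also have "\<dots> = 5 * a * b * (7 * a - b) - R * (3 * a + b)"
    unfolding V1 t1 by (simp add: field_simps)
  finally show "20 * (T1 + 5 * V1) = 5 * a * b * (7 * a - b) - R * (3 * a + b)" .
  have "20 * (2 * T2 + 5 * V2) = 40 * T2 + 100 * V2" by simp
  also have "\<dots> = 5 * a * b * (a + 7 * b) - R * (a - 3 * b)"
    unfolding V2 t2 by (simp add: field_simps)
  finally show "20 * (2 * T2 + 5 * V2) = 5 * a * b * (a + 7 * b) - R * (a - 3 * b)" .
  have "50 * TT = 100 * J1 * T1 + 100 * V1"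
    unfolding TT by (simp add: algebra_simps)
  also have "\<dots> = 50 * (a ^ 2 * b)"
    unfolding V1 t1 J1 by (simp add: field_simps power2_eq_square)
  finally have tt: "TT = a ^ 2 * b" by simp
  have "2 * UU = 2 * (TT * (J1 - J2) - T1 ^ 2)"
    using C by (simp add: algebra_simps power2_eq_square)
  hence uu: "UU = TT * (J1 - J2) - T1 ^ 2"
    by (subst (asm) mult_cancel_left) simp
  show "20 * (TT + 5 * UU) = 20 * a ^ 3 * b + 15 * a ^ 2 * b ^ 2 - 10 * a * b * R - R ^ 2"
    unfolding uu tt t1 J1 J2 by (simp add: field_simps power2_eq_square power3_eq_cube)
qed

lemma form_relations:
  assumes q: "0 < norm q" "norm q < 1"
  defines "a \<equiv> form_a q" and "b \<equiv> form_b q" and "R \<equiv> form_r q"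
  shows "300 * theta_ser 0 1 q = 66 * a * b - a ^ 2 + 11 * b ^ 2 - 18 * a - 6 * b - 6"
    and "300 * theta_ser 0 2 q = 11 * a ^ 2 - 66 * a * b - b ^ 2 - 12 * a + 36 * b - 24"
    and "20 * (zeta_ser 1 1 q + 5 * theta_ser 1 1 q) = 5 * a * b * (7 * a - b) - R * (3 * a + b)"
    and "20 * (2 * zeta_ser 1 2 q + 5 * theta_ser 1 2 q) = 5 * a * b * (a + 7 * b) - R * (a - 3 * b)"
    and "20 * (zeta_ser 2 1 q + 5 * theta_ser 2 1 q) = 20 * a ^ 3 * b + 15 * a ^ 2 * b ^ 2 - 10 * a * b * R - R ^ 2"
proof -
  obtain K where K: "\<And>i. 0 < i \<Longrightarrow> i < 5 \<Longrightarrow> zeta_ser 1 i q = zeta_ser 0 i q ^ 2 + 2 * theta_ser 0 i q + K"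
    and TT: "\<And>i. 0 < i \<Longrightarrow> i < 5 \<Longrightarrow> zeta_ser 2 i q = 2 * zeta_ser 0 i q * zeta_ser 1 i q + 2 * theta_ser 1 i q"
    using heat_equations[OF q] by blast
  have "zeta_ser 0 1 q * zeta_ser 0 1 q - zeta_ser 0 2 q * (zeta_ser 0 1 q + zeta_ser 0 1 q) = theta_ser 0 1 q + theta_ser 0 1 q + theta_ser 0 2 q"
    using three_term_0[OF q, of 1 1] by (simp del: One_nat_def)
  moreover have "zeta_ser 0 2 q * zeta_ser 0 2 q - (1 - zeta_ser 0 1 q) * (zeta_ser 0 2 q + zeta_ser 0 2 q)
      = theta_ser 0 2 q + theta_ser 0 2 q + (theta_ser 0 1 q + zeta_ser 0 1 q - 1 / 2)"
    using three_term_0[OF q, of 2 2] by (simp add: reflections)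
  moreover have "zeta_ser 1 1 q * zeta_ser 0 2 q - zeta_ser 0 1 q * zeta_ser 1 2 q - (1 - zeta_ser 0 2 q) * (zeta_ser 1 1 q - zeta_ser 1 2 q)
      = theta_ser 1 1 q - theta_ser 1 2 q"
    using three_term_1[OF q, of 1 2] by (simp add: reflections del: One_nat_def)
  moreover have "zeta_ser 1 1 q * (1 - zeta_ser 0 2 q) - zeta_ser 0 1 q * zeta_ser 1 2 q - (1 - zeta_ser 0 1 q) * (zeta_ser 1 1 q - zeta_ser 1 2 q)
      = theta_ser 1 1 q + (theta_ser 1 2 q + zeta_ser 1 2 q)"
    using three_term_1[OF q, of 1 3] by (simp add: reflections del: One_nat_def)
  moreover have "zeta_ser 2 1 q * zeta_ser 0 1 q - 2 * zeta_ser 1 1 q * zeta_ser 1 1 q + zeta_ser 0 1 q * zeta_ser 2 1 q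
      - zeta_ser 0 2 q * (zeta_ser 2 1 q + zeta_ser 2 1 q) = theta_ser 2 1 q + theta_ser 2 1 q"
    using three_term_2[OF q, of 1 1] by (simp del: One_nat_def)
  moreover have "zeta_ser 1 1 q = zeta_ser 0 1 q ^ 2 + 2 * theta_ser 0 1 q + K" "zeta_ser 1 2 q = zeta_ser 0 2 q ^ 2 + 2 * theta_ser 0 2 q + K"
    "zeta_ser 2 1 q = 2 * zeta_ser 0 1 q * zeta_ser 1 1 q + 2 * theta_ser 1 1 q" by (intro K TT; simp)+
  moreover have "a = 3 * zeta_ser 0 1 q + zeta_ser 0 2 q - 1" "b = zeta_ser 0 1 q - 3 * zeta_ser 0 2 q + 1"
      "R = 10 * zeta_ser 1 1 q - 5 * a * b"
    by (simp_all add: a_def b_def R_def form_a_def form_b_def form_r_def)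
  ultimately show "300 * theta_ser 0 1 q = 66 * a * b - a ^ 2 + 11 * b ^ 2 - 18 * a - 6 * b - 6"
    "300 * theta_ser 0 2 q = 11 * a ^ 2 - 66 * a * b - b ^ 2 - 12 * a + 36 * b - 24"
    "20 * (zeta_ser 1 1 q + 5 * theta_ser 1 1 q) = 5 * a * b * (7 * a - b) - R * (3 * a + b)"
    "20 * (2 * zeta_ser 1 2 q + 5 * theta_ser 1 2 q) = 5 * a * b * (a + 7 * b) - R * (a - 3 * b)"
    "20 * (zeta_ser 2 1 q + 5 * theta_ser 2 1 q) = 20 * a ^ 3 * b + 15 * a ^ 2 * b ^ 2 - 10 * a * b * R - R ^ 2"
    by (rule level_five_algebra)+
qed

text \<open>
The bridge between the two descriptions of \<open>E\<close>: quadratic in the weight one forms, and linear in \<open>J\<close> and \<open>H\<close>,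
which is how it arises from the infinite product.
\<close>

lemma form_e_eq:
  assumes "0 < norm q" "norm q < 1"
  shows "form_e q = 1 - 5 * zeta_ser 0 1 q + 10 * zeta_ser 0 2 q - 5 / 2 + 25 * (theta_ser 0 2 q - theta_ser 0 1 q)"
proof -
  have J: "zeta_ser 0 1 q = (3 * form_a q + form_b q + 2) / 10" "zeta_ser 0 2 q = (form_a q - 3 * form_b q + 4) / 10"
    by (simp_all add: form_a_def form_b_def)
  have "12 * form_e q = 12 - 60 * zeta_ser 0 1 q + 120 * zeta_ser 0 2 q - 30 + (300 * theta_ser 0 2 q - 300 * theta_ser 0 1 q)"
    unfolding form_e_def form_relations(1,2)[OF assms] J by (simp add: field_simps)
  also have "\<dots> = 12 * (1 - 5 * zeta_ser 0 1 q + 10 * zeta_ser 0 2 q - 5 / 2 + 25 * (theta_ser 0 2 q - theta_ser 0 1 q))"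
    by (simp add: algebra_simps)
  finally show ?thesis by (subst (asm) mult_cancel_left) simp
qed

text \<open>
An analogue for level five of Ramanujan's differential equations for the Eisenstein series \<open>P, Q, R\<close>.
\<close>

lemma level_five_ramanujan_system:
  assumes q: "0 < norm q" "norm q < 1"
  defines "a \<equiv> form_a q" and "b \<equiv> form_b q" and "R \<equiv> form_r q"
  shows "(form_a has_field_derivative a * (11 * a * b + 2 * b ^ 2 - R) / 2 / q) (at q)"
    and "(form_b has_field_derivative b * (2 * a ^ 2 - 11 * a * b - R) / 2 / q) (at q)"
    and "(form_r has_field_derivative (5 * a * b * (2 * a ^ 2 + 3 * a * b - 2 * b ^ 2) - R ^ 2) / 2 / q) (at q)"
proof -
  have q0: "q \<noteq> 0" using q by auto
  note rel = form_relations[OF q, folded a_def b_def R_def]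
  obtain D1 where D1: "(zeta_ser 0 1 has_field_derivative D1) (at q)" "q * D1 = zeta_ser 1 1 q + 5 * theta_ser 1 1 q"
    using zeta_ser_has_derivative[OF q(2), of 1 0] by auto
  obtain D2 where D2: "(zeta_ser 0 2 has_field_derivative D2) (at q)" "q * D2 = 2 * zeta_ser 1 2 q + 5 * theta_ser 1 2 q"
    using zeta_ser_has_derivative[OF q(2), of 2 0] by auto
  obtain D3 where D3: "(zeta_ser 1 1 has_field_derivative D3) (at q)" "q * D3 = zeta_ser 2 1 q + 5 * theta_ser 2 1 q"
    using zeta_ser_has_derivative[OF q(2), of 1 1] by (auto simp: numeral_2_eq_2)
  have div: "X = Y / 2 / q" if "20 * (q * X) = 10 * Y" for X Y
  proof -
    have "10 * (2 * (q * X)) = 10 * Y" using that by simp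
    hence "2 * (q * X) = Y" by (subst (asm) mult_cancel_left) simp
    thus ?thesis using q0 by (simp add: field_simps)
  qed
  have "20 * (q * (3 * D1 + D2)) = 3 * (20 * (q * D1)) + 20 * (q * D2)" by (simp add: algebra_simps)
  also have "\<dots> = 10 * (a * (11 * a * b + 2 * b ^ 2 - R))"
    unfolding D1(2) D2(2) rel by (simp add: algebra_simps power2_eq_square)
  finally have da: "3 * D1 + D2 = a * (11 * a * b + 2 * b ^ 2 - R) / 2 / q" by (rule div)
  have "20 * (q * (D1 - 3 * D2)) = 20 * (q * D1) - 3 * (20 * (q * D2))" by (simp add: algebra_simps)
  also have "\<dots> = 10 * (b * (2 * a ^ 2 - 11 * a * b - R))"
    unfolding D1(2) D2(2) rel by (simp add: algebra_simps power2_eq_square)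
  finally have db: "D1 - 3 * D2 = b * (2 * a ^ 2 - 11 * a * b - R) / 2 / q" by (rule div)
  show A: "(form_a has_field_derivative a * (11 * a * b + 2 * b ^ 2 - R) / 2 / q) (at q)"
    unfolding form_a_def [abs_def] da [symmetric] by (auto intro!: derivative_eq_intros D1 D2 simp del: One_nat_def)
  show B: "(form_b has_field_derivative b * (2 * a ^ 2 - 11 * a * b - R) / 2 / q) (at q)"
    unfolding form_b_def [abs_def] db [symmetric] by (auto intro!: derivative_eq_intros D1 D2 simp del: One_nat_def)
  have "10 * D3 - 5 * (a * (b * (2 * a ^ 2 - 11 * a * b - R) / 2 / q) + b * (a * (11 * a * b + 2 * b ^ 2 - R) / 2 / q))
     = (5 * a * b * (2 * a ^ 2 + 3 * a * b - 2 * b ^ 2) - R ^ 2) / 2 / q"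
  proof (rule div)
    have "20 * (q * (10 * D3 - 5 * (a * (b * (2 * a ^ 2 - 11 * a * b - R) / 2 / q)
           + b * (a * (11 * a * b + 2 * b ^ 2 - R) / 2 / q))))
        = 10 * (20 * (q * D3)) - 50 * (a * (b * (2 * a ^ 2 - 11 * a * b - R)) + b * (a * (11 * a * b + 2 * b ^ 2 - R)))"
      using q0 by (simp add: field_simps)
    also have "\<dots> = 10 * (5 * a * b * (2 * a ^ 2 + 3 * a * b - 2 * b ^ 2) - R ^ 2)"
      unfolding D3(2) rel by (simp add: algebra_simps power2_eq_square power3_eq_cube)
    finally show "20 * (q * (10 * D3 - 5 * (a * (b * (2 * a ^ 2 - 11 * a * b - R) / 2 / q)
           + b * (a * (11 * a * b + 2 * b ^ 2 - R) / 2 / q))))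
        = 10 * (5 * a * b * (2 * a ^ 2 + 3 * a * b - 2 * b ^ 2) - R ^ 2)" .
  qed
  moreover have "(form_r has_field_derivative
      10 * D3 - 5 * (a * (b * (2 * a ^ 2 - 11 * a * b - R) / 2 / q) + b * (a * (11 * a * b + 2 * b ^ 2 - R) / 2 / q))) (at q)"
    using DERIV_diff[OF DERIV_cmult[OF D3(1), of 10] DERIV_cmult[OF DERIV_mult[OF A B], of 5]]
    by (simp add: form_r_def [abs_def] a_def b_def mult_ac add_ac)
  ultimately show "(form_r has_field_derivative (5 * a * b * (2 * a ^ 2 + 3 * a * b - 2 * b ^ 2) - R ^ 2) / 2 / q) (at q)"
    by simp
qed

section \<open>The infinite product\<close>

definition residue_prod :: "nat \<Rightarrow> complex \<Rightarrow> complex" where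
  "residue_prod i q = (\<Prod>k. 1 - q ^ (5 * k + i))"

lemma
  assumes i: "0 < i"
  shows residue_prod_convergent: "norm q < 1 \<Longrightarrow> convergent_prod (\<lambda>k. 1 - q ^ (5 * k + i))"
    and residue_prod_nonzero: "norm q < 1 \<Longrightarrow> residue_prod i q \<noteq> 0"
    and residue_prod_uniform_limit: "r < 1 \<Longrightarrow> uniform_limit (cball 0 r) (\<lambda>N q. \<Prod>k<N. 1 - q ^ (5 * k + i)) (residue_prod i) sequentially"
proof -
  have bound: "norm (q ^ (5 * k + i)) \<le> r ^ k" if "norm q \<le> r" "r < 1" for q :: complex and r k
  proof -
    have r: "0 \<le> r" using that(1) norm_ge_zero[of q] by linarith
    have "norm q ^ (5 * k + i) \<le> r ^ (5 * k + i)" using that by (intro power_mono) auto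
    also have "\<dots> \<le> r ^ k" using that r by (intro power_decreasing) auto
    finally show ?thesis by (simp add: norm_power)
  qed
  have ne: "1 - q ^ (5 * k + i) \<noteq> 0" if "norm q < 1" for q :: complex and k
    using norm_one_minus_power_ge[of q "norm q" "5 * k + i"] that i by auto
  have conv: "convergent_prod (\<lambda>k. 1 - q ^ (5 * k + i))" if "norm q < 1" for q :: complex
  proof -
    have "convergent_prod (\<lambda>k. 1 + - (q ^ (5 * k + i)))"
    proof (rule summable_imp_convergent_prod_complex)
      show "summable (\<lambda>k. norm (- (q ^ (5 * k + i))))"
        by (rule summable_comparison_test'[OF summable_geometric[of "norm q"], of 0])
           (use bound[of q "norm q"] that in auto)
      show "- (q ^ (5 * k + i)) \<noteq> - 1" for k using ne[OF that, of k] by simp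
    qed
    thus ?thesis by simp
  qed
  show "convergent_prod (\<lambda>k. 1 - q ^ (5 * k + i))" if "norm q < 1" using conv[OF that] .
  show "residue_prod i q \<noteq> 0" if "norm q < 1"
    unfolding residue_prod_def by (intro prodinf_nonzero conv ne that)
  show "uniform_limit (cball 0 r) (\<lambda>N q. \<Prod>k<N. 1 - q ^ (5 * k + i)) (residue_prod i) sequentially" if r: "r < 1"
  proof -
    have "uniformly_convergent_on (cball 0 r) (\<lambda>N q. \<Prod>k<N. 1 - q ^ (5 * k + i) :: complex)"
    proof (rule uniformly_convergent_on_prod')
      show "uniformly_convergent_on (cball 0 r) (\<lambda>N q. \<Sum>k<N. norm (1 - q ^ (5 * k + i) - 1 :: complex))"
      proof (cases "r \<ge> 0")
        case True
        show ?thesis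
          by (rule Weierstrass_m_test'[where M = "\<lambda>k. r ^ k"]) (use bound r True in auto)
      next
        case False
        hence "cball 0 r = ({} :: complex set)" by auto
        thus ?thesis by (simp add: uniformly_convergent_on_def)
      qed
    qed (auto intro!: continuous_intros)
    hence "uniform_limit (cball 0 r) (\<lambda>N q. \<Prod>k<N. 1 - q ^ (5 * k + i))
        (\<lambda>q. lim (\<lambda>N. \<Prod>k<N. 1 - q ^ (5 * k + i) :: complex)) sequentially"
      by (simp add: uniformly_convergent_uniform_limit_iff)
    moreover have "lim (\<lambda>N. \<Prod>k<N. 1 - q ^ (5 * k + i)) = residue_prod i q" if "q \<in> cball 0 r" for q
      unfolding residue_prod_def by (subst prodinf_eq_lim'[OF conv ne]) (use that r in auto)
    ultimately show ?thesis by (metis (mono_tags, lifting) uniform_limit_cong')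
  qed
qed

text \<open>
A locally uniform limit of polynomials.
\<close>

lemma residue_prod_holomorphic:
  assumes "0 < i"
  shows "residue_prod i holomorphic_on ball 0 1"
proof (rule holomorphic_uniform_sequence)
  show "\<exists>d>0. cball x d \<subseteq> ball 0 1 \<and> uniform_limit (cball x d) (\<lambda>N q. \<Prod>k<N. 1 - q ^ (5 * k + i)) (residue_prod i) sequentially"
    if "x \<in> ball 0 1" for x
  proof -
    define d where "d = (1 - norm x) / 2"
    have d: "d > 0" "norm x + d < 1" using that by (auto simp: d_def field_simps)
    have "cball x d \<subseteq> cball 0 (norm x + d)"
      using norm_triangle_ineq2 by (intro subsetI) (smt (verit) dist_0_norm dist_commute mem_cball dist_norm norm_triangle_sub)
    moreover from this have "cball x d \<subseteq> ball 0 1" using d by auto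
    ultimately show ?thesis
      using d uniform_limit_on_subset[OF residue_prod_uniform_limit[OF assms d(2)]] by blast
  qed
qed (auto intro!: holomorphic_intros)

lemma residue_prod_at_0: "0 < i \<Longrightarrow> residue_prod i 0 = 1"
  by (simp add: residue_prod_def power_0_left)

text \<open>
The logarithmic derivative of the product runs over exponents in a residue class modulo \<open>5\<close>, whereas \<open>lambert1\<close>
and \<open>lambert2\<close> have the residue in the power of \<open>q\<close>. Both are iterated sums of the double series
\<open>(5 k + i) q^((5 k + i) n)\<close>, in the two possible orders.
\<close>

lemma lambert_swap:
  assumes q: "norm q < 1" and i: "0 < i"
  shows "(\<lambda>k. of_nat (5 * k + i) * (q ^ (5 * k + i) / (1 - q ^ (5 * k + i))))
      sums (of_nat i * lambert1 0 i q + 5 * lambert2 0 i q)"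
proof -
  \<comment> \<open>The row sums of \<open>F\<close> are geometric series and give the left-hand side, the column sums give the right-hand side.\<close>
  define F where "F k n = of_nat (5 * k + i) * (q ^ (5 * k + i)) ^ n" for k n
  \<comment> \<open>Since \<open>(5 k + i) n \<ge> k + (n - 1)\<close>, the double series is dominated by a product of two simple series.\<close>
  define g :: "nat \<times> nat \<Rightarrow> complex" where
    "g = (\<lambda>(k, n). (of_real (real (5 * k + i) * norm q ^ k)) * of_real (norm q ^ (n - 1)))"
  have "(\<lambda>k. of_real (real (5 * k + i) * norm q ^ k) :: complex) summable_on UNIV"
  proof -
    have "summable (\<lambda>k. 5 * (of_nat k ^ 1 * norm q ^ k) + real i * (of_nat k ^ 0 * norm q ^ k))"
      using q by (intro summable_add summable_mult summable_power_times_geometric) auto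
    hence "summable (\<lambda>k. real (5 * k + i) * norm q ^ k)" by (simp add: algebra_simps)
    hence "(\<lambda>k. real (5 * k + i) * norm q ^ k) summable_on UNIV"
      by (intro summable_nonneg_imp_summable_on) auto
    thus ?thesis by (rule summable_on_of_real)
  qed
  moreover have "(\<lambda>n. of_real (norm q ^ (n - 1)) :: complex) summable_on {1..}"
  proof -
    have "(\<lambda>n. norm q ^ n) summable_on UNIV"
      using q by (intro summable_nonneg_imp_summable_on summable_geometric) auto
    hence "(\<lambda>n. norm q ^ (n - 1)) summable_on {1..}"
      by (subst summable_on_reindex_bij_witness[where i = Suc and j = "\<lambda>n. n - 1" and T = UNIV and h = "\<lambda>n. norm q ^ n"]) auto
    thus ?thesis by (rule summable_on_of_real)
  qed
  ultimately have "g summable_on UNIV \<times> {1..}"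
    unfolding g_def using has_sum_product_complex[OF has_sum_infsum has_sum_infsum] has_sum_imp_summable
    by blast
  hence "(\<lambda>p. norm (g p)) summable_on UNIV \<times> {1..}"
    by (simp add: summable_on_iff_abs_summable_on_complex)
  hence "(\<lambda>p. norm (case p of (k, n) \<Rightarrow> F k n)) summable_on UNIV \<times> {1..}"
  proof (rule Infinite_Sum.abs_summable_on_comparison_test')
    fix p :: "nat \<times> nat" assume "p \<in> UNIV \<times> {1..}"
    then obtain k n where p: "p = (k, n)" and "n \<in> {1..}" by auto
    hence "k \<le> k * n" "n \<le> i * n" using i by auto
    hence "k + (n - 1) \<le> 5 * (k * n) + i * n" by linarith
    also have "\<dots> = (5 * k + i) * n" by (simp add: algebra_simps)
    finally have "norm q ^ ((5 * k + i) * n) \<le> norm q ^ (k + (n - 1))"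
      using q by (intro power_decreasing) auto
    thus "norm (case p of (k, n) \<Rightarrow> F k n) \<le> norm (g p)"
      by (simp add: p F_def g_def norm_mult norm_power power_mult power_add mult.assoc mult_left_mono
            del: of_nat_add of_nat_mult of_real_power)
  qed
  hence "(\<lambda>(k, n). F k n) summable_on UNIV \<times> {1..}"
    by (rule Infinite_Sum.abs_summable_summable)
  then obtain S where S: "((\<lambda>(k, n). F k n) has_sum S) (UNIV \<times> {1..})" by (auto simp: summable_on_def)
  have lt: "norm (q ^ m) < 1" if "m > 0" for m
    using that q by (simp add: norm_power power_less_one_iff)
  have "((\<lambda>k. of_nat (5 * k + i) * (q ^ (5 * k + i) / (1 - q ^ (5 * k + i)))) has_sum S) UNIV"
  proof (rule has_sum_SigmaD[OF S])
    show "((\<lambda>n. case (k, n) of (k, n) \<Rightarrow> F k n) has_sum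
        of_nat (5 * k + i) * (q ^ (5 * k + i) / (1 - q ^ (5 * k + i)))) {1..}" for k
      unfolding F_def prod.case
      by (intro has_sum_cmult_right has_sum_geometric_from_1 lt) (use i in simp)
  qed
  hence 1: "(\<lambda>k. of_nat (5 * k + i) * (q ^ (5 * k + i) / (1 - q ^ (5 * k + i)))) sums S"
    by (rule has_sum_imp_sums)
  have row: "((\<lambda>k. F k n) has_sum (of_nat i * (of_nat n ^ 0 * (q ^ (i * n) / (1 - q ^ (5 * n))))
      + 5 * (of_nat n ^ 0 * (q ^ (i * n) * q ^ (5 * n) / (1 - q ^ (5 * n)) ^ 2)))) UNIV" if "n \<in> {1..}" for n
  proof -
    \<comment> \<open>The derivative of the geometric series in \<open>y\<close> produces the double denominators.\<close>
    define y where "y = q ^ (5 * n)"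
    have y: "norm y < 1" unfolding y_def using that by (intro lt) auto
    have y1: "y \<noteq> 1" using y by auto
    have s0: "(\<lambda>k. y ^ k) sums (1 / (1 - y))" by (rule geometric_sums[OF y])
    have s1: "(\<lambda>k. of_nat k * y ^ k) sums (y / (1 - y) ^ 2)"
    proof -
      have "(\<lambda>k. of_nat (Suc k) * y ^ k - y ^ k) sums (1 / (1 - y) ^ 2 - 1 / (1 - y))"
        by (intro sums_diff geometric_deriv_sums s0 y)
      moreover have "1 / (1 - y) ^ 2 - 1 / (1 - y) = y / (1 - y) ^ 2"
        using y1 by (simp add: power2_eq_square divide_simps)
      ultimately show ?thesis by (simp add: algebra_simps)
    qed
    have "((\<lambda>k. y ^ k) has_sum (1 / (1 - y))) UNIV"
      by (rule norm_summable_imp_has_sum[OF _ s0]) (use y in \<open>simp add: norm_power summable_geometric\<close>)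
    moreover have "((\<lambda>k. of_nat k * y ^ k) has_sum (y / (1 - y) ^ 2)) UNIV"
      by (rule norm_summable_imp_has_sum[OF _ s1])
         (use y summable_power_times_geometric[of "norm y" 1] in \<open>simp add: norm_mult norm_power\<close>)
    ultimately have "((\<lambda>k. of_nat i * q ^ (i * n) * y ^ k + 5 * q ^ (i * n) * (of_nat k * y ^ k)) has_sum
       (of_nat i * q ^ (i * n) * (1 / (1 - y)) + 5 * q ^ (i * n) * (y / (1 - y) ^ 2))) UNIV"
      by (intro has_sum_add has_sum_cmult_right)
    moreover have "of_nat i * q ^ (i * n) * y ^ k + 5 * q ^ (i * n) * (of_nat k * y ^ k) = F k n" for k
    proof -
      have "(q ^ (5 * k + i)) ^ n = q ^ (i * n) * y ^ k"
        unfolding y_def by (simp add: power_add power_mult_distrib mult_ac flip: power_mult)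
      thus ?thesis by (simp add: F_def algebra_simps)
    qed
    ultimately show ?thesis by (simp add: y_def mult.assoc)
  qed
  have "((\<lambda>(n, k). F k n) has_sum S) ({1..} \<times> UNIV)"
    using S by (subst (asm) has_sum_swap) simp
  hence "((\<lambda>n. of_nat i * (of_nat n ^ 0 * (q ^ (i * n) / (1 - q ^ (5 * n))))
      + 5 * (of_nat n ^ 0 * (q ^ (i * n) * q ^ (5 * n) / (1 - q ^ (5 * n)) ^ 2))) has_sum S) {1..}"
    by (rule has_sum_SigmaD) (use row in simp)
  moreover have "((\<lambda>n. of_nat i * (of_nat n ^ 0 * (q ^ (i * n) / (1 - q ^ (5 * n))))
      + 5 * (of_nat n ^ 0 * (q ^ (i * n) * q ^ (5 * n) / (1 - q ^ (5 * n)) ^ 2))) has_sum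
      (of_nat i * lambert1 0 i q + 5 * lambert2 0 i q)) {1..}"
    by (intro has_sum_add has_sum_cmult_right lambert_has_sum q i)
  ultimately show ?thesis using 1 has_sum_unique by blast
qed

lemma residue_prod_has_derivative:
  assumes q: "norm q < 1" and i: "0 < i"
  obtains D where "(residue_prod i has_field_derivative D) (at q)"
    and "q * D = - residue_prod i q * (of_nat i * lambert1 0 i q + 5 * lambert2 0 i q)"
proof
  show "(residue_prod i has_field_derivative deriv (residue_prod i) q) (at q)"
    using residue_prod_holomorphic[OF i] q by (intro holomorphic_derivI[of _ "ball 0 1"]) auto
  define r where "r = (norm q + 1) / 2"
  have r: "norm q < r" "r < 1" using q by (auto simp: r_def)
  have "uniform_limit (ball 0 r) (\<lambda>N q. \<Prod>k<N. 1 - q ^ (5 * k + i)) (residue_prod i) sequentially"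
    by (rule uniform_limit_on_subset[OF residue_prod_uniform_limit[OF i r(2)]]) auto
  hence "(\<lambda>k. deriv (\<lambda>q. 1 - q ^ (5 * k + i)) q / (1 - q ^ (5 * k + i))) sums (deriv (residue_prod i) q / residue_prod i q)"
    by (rule logderiv_prodinf_complex_uniform_limit) (use r residue_prod_nonzero[OF i q] in \<open>auto intro!: holomorphic_intros\<close>)
  moreover have "deriv (\<lambda>q. 1 - q ^ (5 * k + i)) q = - (of_nat (5 * k + i) * q ^ (5 * k + i - 1))" for k
    by (rule DERIV_imp_deriv) (auto intro!: derivative_eq_intros)
  ultimately have *: "(\<lambda>k. - q * (- (of_nat (5 * k + i) * q ^ (5 * k + i - 1)) / (1 - q ^ (5 * k + i))))
      sums (- q * (deriv (residue_prod i) q / residue_prod i q))"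
    by (intro sums_mult) simp
  have eq: "- q * (- (of_nat (5 * k + i) * q ^ (5 * k + i - 1)) / (1 - q ^ (5 * k + i)))
     = of_nat (5 * k + i) * (q ^ (5 * k + i) / (1 - q ^ (5 * k + i)))" for k
  proof -
    have "q * q ^ (5 * k + i - 1) = q ^ (5 * k + i)"
      using i by (metis add_gr_0 power_minus_mult mult.commute)
    thus ?thesis by (simp add: mult_ac)
  qed
  have eq': "- q * (deriv (residue_prod i) q / residue_prod i q) = of_nat i * lambert1 0 i q + 5 * lambert2 0 i q"
    by (rule sums_unique2[OF *[unfolded eq] lambert_swap[OF q i]])
  show "q * deriv (residue_prod i) q = - residue_prod i q * (of_nat i * lambert1 0 i q + 5 * lambert2 0 i q)"
    unfolding eq' [symmetric] using residue_prod_nonzero[OF i q] by simp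
qed

text \<open>
The function \<open>g\<close> of the theorem as a function of the nome.
\<close>

definition theta_quotient :: "complex \<Rightarrow> complex" where
  "theta_quotient q = q * (residue_prod 4 q ^ 5 * residue_prod 1 q ^ 5) / (residue_prod 3 q ^ 5 * residue_prod 2 q ^ 5)"

lemma g5_conv_theta_quotient:
  assumes "norm (nome \<tau>) < 1"
  shows "g5 \<tau> = theta_quotient (nome \<tau>)"
proof -
  define q where "q = nome \<tau>"
  have q: "norm q < 1" using assms by (simp add: q_def)
  have c: "convergent_prod (\<lambda>k. (1 - q ^ (5 * k + i)) ^ 5)" "(\<Prod>k. (1 - q ^ (5 * k + i)) ^ 5) = residue_prod i q ^ 5"
    if "i > 0" for i
    using convergent_prod_power[OF residue_prod_convergent[OF that q]] prodinf_power[OF residue_prod_convergent[OF that q]]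
    by (simp_all add: residue_prod_def)
  have e: "5 * Suc k - 1 = 5 * k + 4" "5 * Suc k - 4 = 5 * k + 1" "5 * Suc k - 2 = 5 * k + 3"
    "5 * Suc k - 3 = 5 * k + 2" for k by auto
  have "g5 \<tau> = q * (\<Prod>k. ((1 - q ^ (5 * k + 4)) ^ 5 * (1 - q ^ (5 * k + 1)) ^ 5) /
       ((1 - q ^ (5 * k + 3)) ^ 5 * (1 - q ^ (5 * k + 2)) ^ 5))"
    unfolding g5_def Let_def q_def [symmetric] e ..
  also have "(\<Prod>k. ((1 - q ^ (5 * k + 4)) ^ 5 * (1 - q ^ (5 * k + 1)) ^ 5) /
       ((1 - q ^ (5 * k + 3)) ^ 5 * (1 - q ^ (5 * k + 2)) ^ 5))
     = (residue_prod 4 q ^ 5 * residue_prod 1 q ^ 5) / (residue_prod 3 q ^ 5 * residue_prod 2 q ^ 5)"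
  proof -
    have cm: "convergent_prod (\<lambda>k. (1 - q ^ (5 * k + i)) ^ 5 * (1 - q ^ (5 * k + l)) ^ 5)"
      "(\<Prod>k. (1 - q ^ (5 * k + i)) ^ 5 * (1 - q ^ (5 * k + l)) ^ 5) = residue_prod i q ^ 5 * residue_prod l q ^ 5"
      if "i > 0" "l > 0" for i l
      using convergent_prod_mult[OF c(1)[OF that(1)] c(1)[OF that(2)]]
        prodinf_mult[OF c(1)[OF that(1)] c(1)[OF that(2)]] c(2) that by simp_all
    show ?thesis
      using prodinf_divide[OF cm(1)[of 4 1] cm(1)[of 3 2]] cm(2)[of 4 1] cm(2)[of 3 2]
      by (simp del: One_nat_def)
  qed
  finally show ?thesis by (simp add: theta_quotient_def q_def)
qed

lemma theta_quotient_holomorphic: "theta_quotient holomorphic_on ball 0 1"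
  unfolding theta_quotient_def [abs_def]
  by (intro holomorphic_intros residue_prod_holomorphic) (auto simp: residue_prod_nonzero)

lemma theta_quotient_nonzero:
  assumes "0 < norm q" "norm q < 1"
  shows "theta_quotient q \<noteq> 0"
  using assms by (auto simp: theta_quotient_def residue_prod_nonzero)

text \<open>
The logarithmic derivatives of the four products and of the factor \<open>q\<close> add up to the linear expression for \<open>E\<close>.
\<close>

lemma theta_quotient_has_derivative:
  assumes q: "0 < norm q" "norm q < 1"
  shows "(theta_quotient has_field_derivative theta_quotient q * form_e q / q) (at q)"
proof -
  have q0: "q \<noteq> 0" using q by auto
  define l where "l i = of_nat i * lambert1 0 i q + 5 * lambert2 0 i q" for i
  have pow: "((\<lambda>q. residue_prod i q ^ 5) has_field_derivative residue_prod i q ^ 5 * (- 5 * l i / q)) (at q)" if "i > 0" for i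
  proof -
    obtain D where D: "(residue_prod i has_field_derivative D) (at q)" "q * D = - residue_prod i q * l i"
      using residue_prod_has_derivative[OF q(2) \<open>i > 0\<close>] by (metis l_def)
    have D': "D = - residue_prod i q * l i / q" using D(2) q0 by (simp add: field_simps)
    show ?thesis
      by (rule DERIV_cong[OF DERIV_power[OF D(1), of 5]])
         (use q0 in \<open>simp add: D' field_simps eval_nat_numeral\<close>)
  qed
  have mult: "((\<lambda>x. f x * g x) has_field_derivative f q * g q * (u + v)) (at q)"
    if "(f has_field_derivative f q * u) (at q)" "(g has_field_derivative g q * v) (at q)" for f g :: "complex \<Rightarrow> complex" and u v
    by (rule DERIV_cong[OF DERIV_mult[OF that]]) (simp add: algebra_simps)
  have divide: "((\<lambda>x. f x / g x) has_field_derivative f q / g q * (u - v)) (at q)"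
    if "(f has_field_derivative f q * u) (at q)" "(g has_field_derivative g q * v) (at q)" "g q \<noteq> 0"
    for f g :: "complex \<Rightarrow> complex" and u v
    by (rule DERIV_cong[OF DERIV_divide[OF that]]) (use that(3) in \<open>simp add: field_simps\<close>)
  have e: "form_e q = 1 + 5 * (l 2 + l 3 - l 1 - l 4)"
    unfolding form_e_eq[OF q] by (simp add: zeta_ser_def theta_ser_def l_def algebra_simps)
  have id: "((\<lambda>x. x) has_field_derivative q * (1 / q)) (at q)"
    using q0 by simp
  have "(theta_quotient has_field_derivative theta_quotient q * (1 / q + (- 5 * l 4 / q + - 5 * l 1 / q) - (- 5 * l 3 / q + - 5 * l 2 / q))) (at q)"
    unfolding theta_quotient_def [abs_def]
    by (rule divide mult id pow zero_less_numeral zero_less_one)+ (simp add: residue_prod_nonzero q)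
  moreover have "1 / q + (- 5 * l 4 / q + - 5 * l 1 / q) - (- 5 * l 3 / q + - 5 * l 2 / q) = form_e q / q"
    unfolding e using q0 by (simp add: field_simps)
  ultimately show ?thesis by simp
qed

lemma theta_quotient_0: "theta_quotient 0 = 0" and theta_quotient_deriv_0: "(theta_quotient has_field_derivative 1) (at 0)"
proof -
  show "theta_quotient 0 = 0" by (simp add: theta_quotient_def)
  have "(\<lambda>q. (residue_prod 4 q ^ 5 * residue_prod 1 q ^ 5) / (residue_prod 3 q ^ 5 * residue_prod 2 q ^ 5)) holomorphic_on ball 0 1"
    by (intro holomorphic_intros residue_prod_holomorphic) (auto simp: residue_prod_nonzero)
  then obtain D where "((\<lambda>q. (residue_prod 4 q ^ 5 * residue_prod 1 q ^ 5) / (residue_prod 3 q ^ 5 * residue_prod 2 q ^ 5)) has_field_derivative D) (at 0)"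
    using holomorphic_derivI[of _ "ball 0 1" 0] by auto
  from DERIV_mult[OF DERIV_ident this] show "(theta_quotient has_field_derivative 1) (at 0)"
    by (simp add: theta_quotient_def [abs_def] residue_prod_at_0)
qed

lemma zeta_ser_holomorphic: "0 < i \<Longrightarrow> i < 5 \<Longrightarrow> zeta_ser j i holomorphic_on ball 0 1"
  unfolding holomorphic_on_def
  by (metis zeta_ser_has_derivative field_differentiable_at_within field_differentiable_def mem_ball_0)

lemma form_a_holomorphic: "form_a holomorphic_on ball 0 1"
  and form_b_holomorphic: "form_b holomorphic_on ball 0 1"
  unfolding form_a_def [abs_def] form_b_def [abs_def]
  by (intro holomorphic_intros zeta_ser_holomorphic; simp)+

lemma form_a_0: "form_a 0 = 1" and form_b_0: "form_b 0 = 0"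
  by (simp_all add: form_a_def form_b_def zeta_ser_def)

lemma form_b_deriv_0: "(form_b has_field_derivative 1) (at 0)"
proof -
  have "(zeta_ser 0 1 has_field_derivative 1) (at 0)" "(zeta_ser 0 2 has_field_derivative 0) (at 0)"
    using zeta_ser_has_derivative[of 0 1 0] zeta_ser_has_derivative[of 0 2 0] by auto
  thus ?thesis unfolding form_b_def [abs_def] by (auto intro!: derivative_eq_intros simp del: One_nat_def)
qed

text \<open>
By the differential system \<open>form_b / form_a\<close> has the same logarithmic derivative as \<open>theta_quotient\<close>. So the two agree
up to a constant near \<open>q = 0\<close>, where \<open>form_a\<close> has no zeros; both vanish at \<open>0\<close> with derivative \<open>1\<close>, which
makes the constant \<open>1\<close>. The equation without denominators then extends to the whole disc.
\<close>

lemma form_b_eq_form_a_times_quotient: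
  assumes "norm q < 1"
  shows "form_b q = form_a q * theta_quotient q"
proof -
  have "continuous (at 0) form_a"
    using form_a_holomorphic holomorphic_on_imp_continuous_on continuous_on_eq_continuous_at
    by (metis centre_in_ball open_ball zero_less_one)
  then obtain e where e: "0 < e" "\<And>z. norm z < e \<Longrightarrow> form_a z \<noteq> 0"
    using continuous_at_avoid[of 0 form_a 0] by (auto simp: form_a_0 dist_norm)
  define \<rho> where "\<rho> = min e 1"
  have \<rho>: "0 < \<rho>" "\<rho> \<le> 1" "\<And>z. norm z < \<rho> \<Longrightarrow> form_a z \<noteq> 0"
    using e by (auto simp: \<rho>_def)
  define S where "S = ball 0 \<rho> - {0 :: complex}"
  have S: "0 < norm z" "norm z < 1" "form_a z \<noteq> 0" if "z \<in> S" for z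
    using that \<rho> by (auto simp: S_def)
  have "((\<lambda>z. form_b z / (form_a z * theta_quotient z)) has_field_derivative 0) (at z)" if z: "z \<in> S" for z
  proof -
    note zn = S(1,2)[OF z]
    have nz: "form_a z \<noteq> 0" "theta_quotient z \<noteq> 0" "z \<noteq> 0" using S[OF z] theta_quotient_nonzero[OF zn] by auto
    have "form_b z * (2 * form_a z ^ 2 - 11 * form_a z * form_b z - form_r z) / 2 / z * (form_a z * theta_quotient z)
      = form_b z * (form_a z * (11 * form_a z * form_b z + 2 * form_b z ^ 2 - form_r z) / 2 / z * theta_quotient z
          + theta_quotient z * form_e z / z * form_a z)"
      using nz(3) by (simp add: form_e_def field_simps)
    thus ?thesis
      by (intro DERIV_cong[OF DERIV_divide[OF level_five_ramanujan_system(2)[OF zn]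
            DERIV_mult[OF level_five_ramanujan_system(1)[OF zn] theta_quotient_has_derivative[OF zn]]]]) (use nz in auto)
  qed
  moreover have "connected S"
    unfolding S_def by (rule connected_punctured_ball) simp
  ultimately have "(\<lambda>z. form_b z / (form_a z * theta_quotient z)) constant_on S"
    by (intro has_field_derivative_0_imp_constant_on) (auto simp: S_def)
  then obtain c where c: "\<And>z. z \<in> S \<Longrightarrow> form_b z / (form_a z * theta_quotient z) = c" by (auto simp: constant_on_def)
  have eq: "form_b z = c * (form_a z * theta_quotient z)" if "z \<in> ball 0 \<rho>" for z
  proof (cases "z = 0")
    case False
    hence "z \<in> S" using that by (simp add: S_def)
    thus ?thesis using c[OF \<open>z \<in> S\<close>] S[OF \<open>z \<in> S\<close>] theta_quotient_nonzero[of z] by (auto simp: field_simps)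
  qed (simp add: form_b_0 theta_quotient_0)
  obtain A' where A': "(form_a has_field_derivative A') (at 0)"
    using holomorphic_derivI[OF form_a_holomorphic, of 0] by auto
  have "((\<lambda>z. c * (form_a z * theta_quotient z)) has_field_derivative c) (at 0)"
    using DERIV_cmult[OF DERIV_mult[OF A' theta_quotient_deriv_0], of c] by (simp add: theta_quotient_0 form_a_0)
  hence "(form_b has_field_derivative c) (at 0)"
    by (rule has_field_derivative_transform_within_open[of _ _ _ "ball 0 \<rho>"]) (use eq \<rho> in auto)
  hence "c = 1" using form_b_deriv_0 DERIV_unique by blast
  show ?thesis
  proof (rule analytic_continuation_open[of "ball 0 \<rho>" "ball 0 1" form_b "\<lambda>q. form_a q * theta_quotient q" q])
    show "(\<lambda>q. form_a q * theta_quotient q) holomorphic_on ball 0 1"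
      by (intro holomorphic_intros form_a_holomorphic theta_quotient_holomorphic)
  qed (use \<rho> eq \<open>c = 1\<close> form_b_holomorphic assms in auto)
qed

section \<open>The Schwarzian equation\<close>

lemma nome_norm:
  assumes "Im \<tau> > 0"
  shows "0 < norm (nome \<tau>)" "norm (nome \<tau>) < 1"
  using assms by (simp_all add: nome_def norm_exp_eq_Re)

lemma nome_chain:
  assumes "(f has_field_derivative D / nome \<tau>) (at (nome \<tau>))"
  shows "((\<lambda>\<tau>. f (nome \<tau>)) has_field_derivative (2 * of_real pi * \<i>) * D) (at \<tau>)"
proof -
  have "(nome has_field_derivative nome \<tau> * (2 * of_real pi * \<i>)) (at \<tau>)"
    unfolding nome_def [abs_def] by (auto intro!: derivative_eq_intros)
  from DERIV_chain2[OF assms this] show ?thesis by (simp add: nome_def mult_ac)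
qed

text \<open>
Here \<open>Da\<close>, \<open>Db\<close> and \<open>DR\<close> are the right-hand sides of the differential system. The first equation is \<open>D E = - E R\<close>;
the second evaluates the combination to which the Schwarzian derivative reduces.
\<close>

lemma schwarzian_algebra:
  fixes a b R :: complex
  defines "E \<equiv> a ^ 2 - 11 * a * b - b ^ 2"
  defines "Da \<equiv> a * (11 * a * b + 2 * b ^ 2 - R) / 2"
    and "Db \<equiv> b * (2 * a ^ 2 - 11 * a * b - R) / 2"
    and "DR \<equiv> (5 * a * b * (2 * a ^ 2 + 3 * a * b - 2 * b ^ 2) - R ^ 2) / 2"
  shows "(2 * a - 11 * b) * Da - (11 * a + 2 * b) * Db = - (E * R)"
    and "R ^ 2 + 2 * DR + E ^ 2 = b ^ 4 + 12 * a * b ^ 3 + 134 * a ^ 2 * b ^ 2 - 12 * a ^ 3 * b + a ^ 4"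
  unfolding E_def Da_def Db_def DR_def
  by (simp_all add: field_simps power2_eq_square power3_eq_cube power4_eq_xxxx)

theorem theorem7p1:
  fixes \<tau> :: complex
  assumes "Im \<tau> > 0"
  shows "schwarzian g5 \<tau> +
      (g5 \<tau> ^ 4 + 12 * g5 \<tau> ^ 3 + 134 * g5 \<tau> ^ 2 - 12 * g5 \<tau> + 1) /
        (2 * g5 \<tau> ^ 2 * (g5 \<tau> ^ 2 + 11 * g5 \<tau> - 1) ^ 2) * (deriv g5 \<tau>) ^ 2 = 0"
proof -
  define H where "H = {\<tau>. Im \<tau> > 0}"
  have H: "open H" "\<tau> \<in> H"
    using assms by (auto simp: H_def open_halfspace_Im_gt)
  define c :: complex where "c = 2 * of_real pi * \<i>"
  define a where "a \<tau> = form_a (nome \<tau>)" for \<tau>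
  define b where "b \<tau> = form_b (nome \<tau>)" for \<tau>
  define R where "R \<tau> = form_r (nome \<tau>)" for \<tau>
  define E where "E \<tau> = form_e (nome \<tau>)" for \<tau>
  define DR where "DR \<tau> = (5 * a \<tau> * b \<tau> * (2 * a \<tau> ^ 2 + 3 * a \<tau> * b \<tau> - 2 * b \<tau> ^ 2) - R \<tau> ^ 2) / 2" for \<tau>
  have E_ab: "E \<tau> = a \<tau> ^ 2 - 11 * a \<tau> * b \<tau> - b \<tau> ^ 2" for \<tau>
    by (simp add: E_def form_e_def a_def b_def)
  have dg: "(g5 has_field_derivative c * (g5 z * E z)) (at z)" if "z \<in> H" for z
  proof -
    have z: "Im z > 0" using that by (simp add: H_def)
    have "((\<lambda>z. theta_quotient (nome z)) has_field_derivative c * (theta_quotient (nome z) * E z)) (at z)"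
      unfolding c_def E_def by (intro nome_chain theta_quotient_has_derivative nome_norm z)
    hence "((\<lambda>z. theta_quotient (nome z)) has_field_derivative c * (g5 z * E z)) (at z)"
      using g5_conv_theta_quotient[OF nome_norm(2)[OF z]] by simp
    thus ?thesis
      by (rule has_field_derivative_transform_within_open[OF _ H(1) that])
         (auto simp: H_def g5_conv_theta_quotient nome_norm)
  qed
  have da: "(a has_field_derivative c * (a z * (11 * a z * b z + 2 * b z ^ 2 - R z) / 2)) (at z)"
    and db: "(b has_field_derivative c * (b z * (2 * a z ^ 2 - 11 * a z * b z - R z) / 2)) (at z)"
    and dR: "(R has_field_derivative c * DR z) (at z)" if "z \<in> H" for z
  proof -
    have z: "Im z > 0" using that by (simp add: H_def)
    note chain = level_five_ramanujan_system[OF nome_norm[OF z], THEN nome_chain]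
    show "(a has_field_derivative c * (a z * (11 * a z * b z + 2 * b z ^ 2 - R z) / 2)) (at z)"
      "(b has_field_derivative c * (b z * (2 * a z ^ 2 - 11 * a z * b z - R z) / 2)) (at z)"
      "(R has_field_derivative c * DR z) (at z)"
      using chain unfolding a_def [abs_def] b_def [abs_def] R_def [abs_def] DR_def c_def by blast+
  qed
  have dE: "(E has_field_derivative c * (- (E z * R z))) (at z)" if "z \<in> H" for z
    unfolding E_ab [abs_def] schwarzian_algebra(1) [symmetric]
    by (rule derivative_eq_intros da[OF that] db[OF that] refl)+ (simp add: field_simps power2_eq_square)
  have d1: "deriv g5 z = c * (g5 z * E z)" if "z \<in> H" for z
    using dg[OF that] by (rule DERIV_imp_deriv)
  have d2: "(deriv g5 has_field_derivative c ^ 2 * (g5 z * E z * (E z - R z))) (at z)" if "z \<in> H" for z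
  proof -
    have "((\<lambda>z. c * (g5 z * E z)) has_field_derivative c ^ 2 * (g5 z * E z * (E z - R z))) (at z)"
      by (rule derivative_eq_intros dg[OF that] dE[OF that] refl)+ (simp add: algebra_simps power2_eq_square)
    thus ?thesis
      by (rule has_field_derivative_transform_within_open[OF _ H(1) that]) (simp add: d1)
  qed
  have d3: "(deriv (deriv g5) has_field_derivative
      c ^ 3 * (g5 z * E z * ((E z - R z) ^ 2 - E z * R z - DR z))) (at z)" if "z \<in> H" for z
  proof -
    have "((\<lambda>z. c ^ 2 * (g5 z * E z * (E z - R z))) has_field_derivative
        c ^ 3 * (g5 z * E z * ((E z - R z) ^ 2 - E z * R z - DR z))) (at z)"
      by (rule derivative_eq_intros dg[OF that] dE[OF that] dR[OF that] refl)+
         (simp add: algebra_simps power2_eq_square power3_eq_cube)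
    thus ?thesis
      by (rule has_field_derivative_transform_within_open[OF _ H(1) that])
         (simp add: DERIV_imp_deriv[OF d2])
  qed
  define g where "g = g5 \<tau>"
  have D1: "deriv g5 \<tau> = c * (g * E \<tau>)"
    using d1 H by (simp add: g_def)
  have D2: "(deriv ^^ 2) g5 \<tau> = c ^ 2 * (g * E \<tau> * (E \<tau> - R \<tau>))"
    using DERIV_imp_deriv[OF d2[OF H(2)]] by (simp add: g_def numeral_2_eq_2)
  have D3: "(deriv ^^ 3) g5 \<tau> = c ^ 3 * (g * E \<tau> * ((E \<tau> - R \<tau>) ^ 2 - E \<tau> * R \<tau> - DR \<tau>))"
    using DERIV_imp_deriv[OF d3[OF H(2)]] by (simp add: g_def numeral_3_eq_3)
  have bg: "b \<tau> = a \<tau> * g"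
    using form_b_eq_form_a_times_quotient[OF nome_norm(2)[OF assms]] g5_conv_theta_quotient[OF nome_norm(2)[OF assms]]
    by (simp add: a_def b_def g_def)
  have E_g: "E \<tau> = - (a \<tau> ^ 2 * (g ^ 2 + 11 * g - 1))"
    unfolding E_ab bg by (simp add: algebra_simps power2_eq_square)
  show ?thesis
  proof (cases "E \<tau> = 0")
    \<comment> \<open>Here \<open>g'\<close> is \<open>0\<close>, so every quotient by it is \<open>0\<close> and the equation reads \<open>0 + 0 = 0\<close>.\<close>
    case True
    thus ?thesis by (simp add: schwarzian_def D1)
  next
    case False
    \<comment> \<open>The denominators do not vanish, as \<open>a\<close> and \<open>g^2 + 11 g - 1\<close> are factors of \<open>E\<close>.\<close>
    have nz: "g \<noteq> 0" "c \<noteq> 0" "a \<tau> \<noteq> 0" "g ^ 2 + 11 * g - 1 \<noteq> 0"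
      using False E_g theta_quotient_nonzero[OF nome_norm[OF assms]] g5_conv_theta_quotient[OF nome_norm(2)[OF assms]]
      by (auto simp: c_def g_def)
    have "schwarzian g5 \<tau> = c ^ 2 * (((E \<tau> - R \<tau>) ^ 2 - E \<tau> * R \<tau> - DR \<tau>) - 3 / 2 * (E \<tau> - R \<tau>) ^ 2)"
      unfolding schwarzian_def D1 D2 D3 using nz False by (simp add: field_simps power2_eq_square power3_eq_cube)
    also have "\<dots> = - (c ^ 2 / 2) * (R \<tau> ^ 2 + 2 * DR \<tau> + E \<tau> ^ 2)"
      by (simp add: field_simps power2_eq_square)
    also have "R \<tau> ^ 2 + 2 * DR \<tau> + E \<tau> ^ 2
       = b \<tau> ^ 4 + 12 * a \<tau> * b \<tau> ^ 3 + 134 * a \<tau> ^ 2 * b \<tau> ^ 2 - 12 * a \<tau> ^ 3 * b \<tau> + a \<tau> ^ 4"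
      unfolding E_ab DR_def by (rule schwarzian_algebra(2))
    also have "\<dots> = a \<tau> ^ 4 * (g ^ 4 + 12 * g ^ 3 + 134 * g ^ 2 - 12 * g + 1)"
      unfolding bg by (simp add: algebra_simps power2_eq_square power3_eq_cube power4_eq_xxxx)
    finally have S: "schwarzian g5 \<tau> = - (c ^ 2 / 2) * (a \<tau> ^ 4 * (g ^ 4 + 12 * g ^ 3 + 134 * g ^ 2 - 12 * g + 1))" .
    have cancel: "N / (2 * u ^ 2 * t ^ 2) * (c * (u * - (A ^ 2 * t))) ^ 2 = N * (c ^ 2 / 2 * A ^ 4)"
      if "u \<noteq> 0" "t \<noteq> 0" for N u t A
      using that by (simp add: field_simps power2_eq_square power4_eq_xxxx)
    have "(g ^ 4 + 12 * g ^ 3 + 134 * g ^ 2 - 12 * g + 1) / (2 * g ^ 2 * (g ^ 2 + 11 * g - 1) ^ 2) * deriv g5 \<tau> ^ 2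
        = (g ^ 4 + 12 * g ^ 3 + 134 * g ^ 2 - 12 * g + 1) * (c ^ 2 / 2 * a \<tau> ^ 4)"
      unfolding D1 E_g by (rule cancel) (use nz in auto)
    thus ?thesis unfolding g_def [symmetric] S by (simp add: algebra_simps)
  qed
qed

end
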